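(* For $\mu,\nu\in\Lambda_2(\mathbb{R}^d)$ let $$\mathcal{C}_2^\Lambda(\mu,\nu)=\inf_{\gamma\in\Gamma^\Lambda(\mu,\nu)}\int_{\mathbb{R}^{2d}}\tfrac12|x-y|^2\,d\gamma(x,y),\qquad\mathcal{W}_\Lambda(\mu,\nu):=\mathcal{C}_2^\Lambda(\mu,\nu)^{1/2}.$$ Then $\mathcal{W}_\Lambda$ is a complete and separable metric on $\Lambda_2(\mathbb{R}^d)$.
   Context: A L\'evy measure on $\mathbb{R}^d$ is a Borel measure $\mu$ with $\mu(\{0\})=0$ and $\int\min\{1,|x|^2\}\,d\mu<\infty$. $\Lambda_2(\mathbb{R}^d)$ is the set of L\'evy measures with $\int_{\mathbb{R}^d}|x|^2\,d\mu(x)<\infty$. For L\'evy measures $\mu,\nu$ on $\mathbb{R}^d$, $\Gamma^\Lambda(\mu,\nu)$ (the L\'evy couplings) is the set of L\'evy measures $\gamma$ on $\mathbb{R}^{2d}$ such that $\gamma(E\times\mathbb{R}^d)=\mu(E)$ and $\gamma(\mathbb{R}^d\times E)=\nu(E)$ for every Borel set $E\subset\mathbb{R}^d$ disjoint from some neighbourhood of $0$. *)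

theory Defs
  imports "HOL-Analysis.Analysis"
begin

definition levy_measure :: "'a::euclidean_space measure \<Rightarrow> bool" where
  "levy_measure \<mu> \<longleftrightarrow>
     sets \<mu> = sets borel \<and>
     emeasure \<mu> {0} = 0 \<and>
     (\<integral>\<^sup>+ x. ennreal (min 1 ((norm x)\<^sup>2)) \<partial>\<mu>) < \<infinity>"

definition levy_measures2 :: "'a::euclidean_space measure set" ("\<Lambda>\<^sub>2") where
  "\<Lambda>\<^sub>2 = {\<mu>. levy_measure \<mu> \<and> (\<integral>\<^sup>+ x. ennreal ((norm x)\<^sup>2) \<partial>\<mu>) < \<infinity>}"

text \<open>
  The space of dimension \<open>2d\<close> is rendered as the product type \<open>'a \<times> 'a\<close>, whose
  library norm is the Euclidean one. The marginals are only prescribed away from the origin,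
  so the coupling may have larger (even infinite) marginal mass at \<open>0\<close>.
\<close>

definition levy_couplings ::
    "'a::euclidean_space measure \<Rightarrow> 'a measure \<Rightarrow> ('a \<times> 'a) measure set" where
  "levy_couplings \<mu> \<nu> =
     {\<gamma>. levy_measure \<gamma> \<and>
        (\<forall>E \<in> sets borel. (\<exists>U. open U \<and> 0 \<in> U \<and> E \<inter> U = {}) \<longrightarrow>
           emeasure \<gamma> (E \<times> UNIV) = emeasure \<mu> E \<and>
           emeasure \<gamma> (UNIV \<times> E) = emeasure \<nu> E)}"

definition levy_cost2 :: "'a::euclidean_space measure \<Rightarrow> 'a measure \<Rightarrow> ennreal" where
  "levy_cost2 \<mu> \<nu> =
     (INF \<gamma> \<in> levy_couplings \<mu> \<nu>.
        \<integral>\<^sup>+ (x, y). ennreal (1 / 2 * (norm (x - y))\<^sup>2) \<partial>\<gamma>)"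

text \<open>
  Since \<open>enn2real \<infinity> = 0\<close>, this real-valued function is the intended one only where
  \<open>levy_cost2\<close> is finite.
\<close>

definition levy_wasserstein :: "'a::euclidean_space measure \<Rightarrow> 'a measure \<Rightarrow> real" where
  "levy_wasserstein \<mu> \<nu> = sqrt (enn2real (levy_cost2 \<mu> \<nu>))"

end

theory Submission
  imports Defs "HOL-Probability.Weak_Convergence"
begin

text \<open>
  The space \<open>\<Lambda>\<^sub>2\<close> is a quotient of the Hilbert space of square-integrable functions
  from the real line to the Euclidean space, and the metric inherits its properties from that space. A function
  \<open>f\<close> is sent to its law under Lebesgue measure with the mass at the origin removed
  (\<open>levy_law\<close>). Two functions \<open>f\<close> and \<open>g\<close> produce a Levy coupling of
  their laws, namely the law of the pair, whose cost is half the squared \<open>L\<^sup>2\<close> distance. So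
  the Wasserstein distance of the laws is at most the distance of the functions divided by \<open>sqrt 2\<close>
  (\<open>levy_cost2_le_L2\<close>). This is where the special treatment of the origin pays off: a point at
  which one function vanishes and the other does not corresponds to mass moved from or to the origin, for which
  the coupling is not constrained.

  Conversely, a coupling can be lifted (\<open>lift_coupling\<close>): given \<open>f\<close> with law
  \<open>\<mu>\<close> and a coupling of \<open>\<mu>\<close> with \<open>\<nu>\<close>, there is
  \<open>g\<close> with law exactly \<open>\<nu>\<close> whose distance to \<open>f\<close> is as close as
  desired to what the coupling prescribes. The proof cuts the coupling into countably many finite parts over
  small cells of the first coordinate and realises each part on the set where \<open>f\<close> takes values in
  the same cell. For this, every finite Borel measure must be the law of a function on a given Borel subset of
  the line of the same measure (\<open>realise_finite_measure_on_line\<close>), which follows from the quantile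
  transformation and a Borel embedding of Euclidean space into the line. Mass that the coupling creates at the
  origin is realised on the zero set of \<open>f\<close>; requiring that zero sets have infinite measure keeps
  room for this, and the lifted function can be chosen with the same property.

  The theorem follows. Every element of \<open>\<Lambda>\<^sub>2\<close> is a law, by lifting from the zero
  function, so costs are finite. Lifting twice puts three measures on one line, which gives the triangle
  inequality. At distance zero, two measures have representations that are arbitrarily close in
  \<open>L\<^sup>2\<close>, and Chebyshev's inequality shows that they agree on closed sets. A fast Cauchy
  sequence of measures lifts step by step to a Cauchy sequence of functions, whose limit has the limiting law.
  Finally, rounding a function to finitely many values from a fixed dense sequence, on sets of rational measure,
  approximates its law by members of a countable family.
\<close>

section \<open>Realising measures by functions on the real line\<close>

text \<open>
  Base three with digits 0 and 1 only: the digits after position \<open>p\<close> contribute at most one half to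
  \<open>3 ^ p * s\<close>, so no carry can disturb the digit read off by the floor function. In base two the
  tail could add up to 1 and the digits would not be recoverable.
\<close>

lemma ternary_digit:
  fixes b :: "nat \<Rightarrow> bool"
  defines "s \<equiv> (\<Sum>j. of_bool (b j) * (1/3) ^ j :: real)"
  shows "\<lfloor>3 ^ p * s\<rfloor> mod 3 = of_bool (b p)"
proof -
  let ?a = "\<lambda>j. of_bool (b j) * (1/3) ^ j :: real"
  have sm: "summable ?a"
    by (rule summable_comparison_test'[of "\<lambda>j. (1/3::real)^j" 0]) (auto intro: summable_geometric)
  have sm2: "summable (\<lambda>j. (1/3::real) ^ Suc p * (1/3) ^ j)"
    by (intro summable_mult summable_geometric) auto
  define T where "T = (\<Sum>j. ?a (j + Suc p))"
  have s: "s = T + (\<Sum>j<Suc p. ?a j)"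
    unfolding s_def T_def using suminf_split_initial_segment[OF sm, of "Suc p"] .
  have smp: "summable (\<lambda>j. ?a (j + Suc p))"
    using summable_iff_shift[of ?a "Suc p"] sm by blast
  have T0: "0 \<le> T" unfolding T_def
    by (intro suminf_nonneg smp) auto
  have "T \<le> (\<Sum>j. (1/3::real) ^ Suc p * (1/3) ^ j)" unfolding T_def
    by (intro suminf_le sm2 smp) (auto simp: power_add)
  also have "\<dots> = (1/3) ^ Suc p * (3/2)"
    by (subst suminf_mult) (auto simp: suminf_geometric)
  finally have T1: "T \<le> (1/3) ^ Suc p * (3/2)" .
  let ?N = "\<Sum>j<p. of_bool (b j) * 3 ^ (p - Suc j) :: int"
  have "(3::real) ^ p * (\<Sum>j<p. ?a j) = (\<Sum>j<p. 3 * (of_bool (b j) * 3 ^ (p - Suc j)))"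
    unfolding sum_distrib_left
  proof (intro sum.cong refl)
    fix j assume "j \<in> {..<p}"
    then have "p = j + Suc (p - Suc j)" by auto
    then have "(3::real) ^ p = 3 ^ j * (3 * 3 ^ (p - Suc j))"
      by (metis power_add power_Suc)
    then show "(3::real) ^ p * ?a j = 3 * (of_bool (b j) * 3 ^ (p - Suc j))"
      by (simp add: field_simps)
  qed
  also have "\<dots> = real_of_int (3 * ?N)"
    by (simp add: sum_distrib_left del: sum_of_bool_mult_eq sum_mult_of_bool_eq)
  finally have "3 ^ p * s = real_of_int (3 * ?N + of_bool (b p)) + 3 ^ p * T"
    unfolding s by (simp add: ring_distribs power_one_over)
  moreover have "0 \<le> 3 ^ p * T" "3 ^ p * T < 1"
    using T0 T1 by (auto simp: field_simps power_one_over)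
  ultimately have "\<lfloor>3 ^ p * s\<rfloor> = 3 * ?N + of_bool (b p)"
    by linarith
  then show ?thesis by simp
qed

lemma dense_sequence_starting_at_zero:
  obtains d :: "nat \<Rightarrow> 'a::euclidean_space"
  where "d 0 = 0" "\<And>X. open X \<Longrightarrow> X \<noteq> {} \<Longrightarrow> \<exists>n. d n \<in> X"
proof -
  obtain D :: "'a set" where D: "countable D" "\<And>X. open X \<Longrightarrow> X \<noteq> {} \<Longrightarrow> \<exists>d\<in>D. d \<in> X"
    using countable_dense_setE by blast
  have "D \<noteq> {}" using D(2)[of UNIV] by auto
  have "\<exists>n. (case n of 0 \<Rightarrow> 0 | Suc k \<Rightarrow> from_nat_into D k) \<in> X" if X: "open X" "X \<noteq> {}" for X
  proof -
    obtain y where "y \<in> D" "y \<in> X" using D(2)[OF X] by blast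
    moreover then obtain k where "from_nat_into D k = y"
      using from_nat_into_surj[OF D(1)] by blast
    ultimately show ?thesis by (intro exI[of _ "Suc k"]) simp
  qed
  then show ?thesis by (intro that[of "\<lambda>n. case n of 0 \<Rightarrow> 0 | Suc k \<Rightarrow> from_nat_into D k"]) auto
qed

text \<open>
  A point is determined by the countably many answers to ``is it within \<open>2 ^ - k\<close> of the
  \<open>n\<close>-th point of a dense sequence?''. Storing the answers as ternary digits gives
  \<open>\<psi>\<close>. The decoder \<open>\<phi>\<close> reads them back: for each \<open>k\<close> it takes
  the first dense point that is close enough, and these points converge to the original one. Thus measures on
  the space can be moved to the line, where quantile functions exist, and back.
\<close>

lemma borel_embedding_into_real:
  obtains \<psi> :: "'a::euclidean_space \<Rightarrow> real" and \<phi> :: "real \<Rightarrow> 'a"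
  where "\<psi> \<in> borel_measurable borel" "\<phi> \<in> borel_measurable borel" "\<And>x. \<phi> (\<psi> x) = x"
proof -
  obtain d :: "nat \<Rightarrow> 'a" where d: "\<And>X. open X \<Longrightarrow> X \<noteq> {} \<Longrightarrow> \<exists>n. d n \<in> X"
    using dense_sequence_starting_at_zero by metis
  define b where "b x p = (case prod_decode p of (k, n) \<Rightarrow> dist x (d n) < (1/2) ^ k)" for x :: 'a and p
  define \<psi> where "\<psi> x = (\<Sum>p. of_bool (b x p) * (1/3) ^ p :: real)" for x
  define c where "c t k n \<longleftrightarrow> \<lfloor>3 ^ prod_encode (k, n) * t\<rfloor> mod 3 = (1::int)" for t :: real and k n
  define \<phi> where "\<phi> t = lim (\<lambda>k. d (LEAST n. c t k n))" for t
  have [measurable]: "Measurable.pred borel (\<lambda>x. b x p)" for p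
    unfolding b_def by (cases "prod_decode p") simp
  have "\<psi> \<in> borel_measurable borel"
    unfolding \<psi>_def by measurable
  moreover have [measurable]: "Measurable.pred borel (\<lambda>t. c t k n)" for k n
    unfolding c_def by measurable
  have "(\<lambda>t. d (LEAST n. c t k n)) \<in> borel_measurable borel" for k
    by (rule measurable_compose[of _ _ "count_space UNIV"]) measurable
  then have "\<phi> \<in> borel_measurable borel"
    unfolding \<phi>_def by (intro borel_measurable_lim_metric)
  moreover have "\<phi> (\<psi> x) = x" for x
  proof -
    have c: "c (\<psi> x) k n \<longleftrightarrow> dist x (d n) < (1/2) ^ k" for k n
      unfolding c_def \<psi>_def ternary_digit by (simp add: b_def)
    have "dist (d (LEAST n. c (\<psi> x) k n)) x < (1/2) ^ k" for k
    proof -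
      have "\<exists>n. dist x (d n) < (1/2) ^ k"
      proof -
        have "x \<in> ball x ((1/2)^k)" by simp
        with d[OF open_ball, of x "(1/2)^k"] obtain n where "d n \<in> ball x ((1/2)^k)" by blast
        then show ?thesis by auto
      qed
      from LeastI_ex[OF this] show ?thesis
        unfolding c by (simp add: dist_commute)
    qed
    moreover have "(\<lambda>k. (1/2::real) ^ k) \<longlonglongrightarrow> 0"
      by (intro LIMSEQ_power_zero) auto
    ultimately have "(\<lambda>k. dist (d (LEAST n. c (\<psi> x) k n)) x) \<longlonglongrightarrow> 0"
      using tendsto_sandwich[of "\<lambda>_. 0" "\<lambda>k. dist (d (LEAST n. c (\<psi> x) k n)) x" sequentially "\<lambda>k. (1/2::real) ^ k" 0]
      by (simp add: less_imp_le)
    then have "(\<lambda>k. d (LEAST n. c (\<psi> x) k n)) \<longlonglongrightarrow> x"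
      by (rule tendsto_dist_iff[THEN iffD2])
    then show ?thesis unfolding \<phi>_def by (rule limI)
  qed
  ultimately show ?thesis by (rule that)
qed

text \<open>
  The quantile function \<open>I\<close> carries the uniform distribution to \<open>M\<close>. In the absence of
  atoms \<open>C\<close> is continuous, hence \<open>C (I \<omega>) = \<omega>\<close>, and so \<open>C\<close>
  carries \<open>M\<close> back to the uniform distribution.
\<close>

lemma (in cdf_distribution) distr_cdf_uniform:
  assumes "\<And>x. measure M {x} = 0"
  shows "distr M borel C = distr (restrict_space lborel {0<..<1}) borel (\<lambda>x. x)"
proof -
  let ?U = "restrict_space lborel {0<..<1::real}"
  have [measurable]: "I \<in> borel_measurable ?U"
    using measurable_CI by (simp cong: measurable_cong_sets add: sets_restrict_space)
  have "C (I \<omega>) = \<omega>" if w: "\<omega> \<in> {0<..<1}" for \<omega>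
  proof (rule antisym)
    have "isCont C (I \<omega>)" using assms isCont_cdf by auto
    then have "(C \<longlongrightarrow> C (I \<omega>)) (at_left (I \<omega>))"
      by (simp add: continuous_at_imp_continuous_within isCont_def filterlim_at_split)
    moreover have "C x \<le> \<omega>" if "x < I \<omega>" for x
      using pseudoinverse[of \<omega> x] w that by force
    ultimately show "C (I \<omega>) \<le> \<omega>"
      by (intro tendsto_upperbound[of C _ "at_left (I \<omega>)"]) (auto simp: eventually_at_filter)
    show "\<omega> \<le> C (I \<omega>)" using pseudoinverse[of \<omega> "I \<omega>"] w by auto
  qed
  then have "distr ?U borel (\<lambda>x. C (I x)) = distr ?U borel (\<lambda>x. x)"
    by (intro distr_cong) (auto simp: space_restrict_space)
  moreover have "distr M borel C = distr (distr ?U borel I) borel C"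
    by (simp add: distr_I_eq_M)
  ultimately show ?thesis by (simp add: distr_distr o_def)
qed

text \<open>
  Lebesgue measure on \<open>D\<close>, once normalised, has no atoms, so its distribution function is uniformly
  distributed. Composing it with the quantile function of the encoded measure \<open>m\<close> and with the
  decoder yields a function on \<open>D\<close> with law \<open>m\<close>.
\<close>

lemma realise_finite_measure_on_line:
  fixes m :: "'a::euclidean_space measure"
  assumes D[measurable]: "D \<in> sets borel" and fin: "emeasure lborel D < \<infinity>"
    and m: "sets m = sets borel" and mass: "emeasure m UNIV = emeasure lborel D"
  obtains g :: "real \<Rightarrow> 'a" where "g \<in> borel_measurable borel"
    "\<And>E. E \<in> sets borel \<Longrightarrow> emeasure lborel (D \<inter> g -` E) = emeasure m E"
proof (cases "emeasure lborel D = 0")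
  case True
  have "emeasure m E = 0" for E
    using mass True emeasure_mono[of E UNIV m] sets_eq_imp_space_eq[OF m]
    by (metis le_zero_eq m sets.top space_borel subset_UNIV)
  moreover have "emeasure lborel (D \<inter> E) = 0" for E
    using True emeasure_mono[of "D \<inter> E" D lborel] by simp
  ultimately show ?thesis by (intro that[of "\<lambda>_. 0"]) auto
next
  case False
  have spm: "space m = UNIV" using sets_eq_imp_space_eq[OF m] by simp
  note [measurable_cong] = m
  obtain \<psi> :: "'a \<Rightarrow> real" and \<phi> where [measurable]: "\<psi> \<in> borel_measurable borel"
    "\<phi> \<in> borel_measurable borel" and \<phi>\<psi>: "\<And>x. \<phi> (\<psi> x) = x"
    using borel_embedding_into_real by blast
  let ?U = "restrict_space lborel {0<..<1::real}"
  define P where "P = uniform_measure lborel D"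
  define m' where "m' = uniform_measure m UNIV"
  define Q where "Q = distr m' borel \<psi>"
  have [measurable_cong]: "sets P = sets borel" "sets m' = sets borel" "sets Q = sets borel"
    by (simp_all add: P_def m'_def Q_def m)
  have P: "prob_space P" unfolding P_def
    by (intro prob_space_uniform_measure) (use False fin in auto)
  have m'_prob: "prob_space m'" unfolding m'_def
    by (intro prob_space_uniform_measure) (use False fin mass in auto)
  have Q: "prob_space Q" unfolding Q_def
    by (intro prob_space.prob_space_distr[OF m'_prob]) measurable
  interpret P: cdf_distribution P
    unfolding cdf_distribution_def real_distribution_def real_distribution_axioms_def
    using P by (simp add: P_def)
  interpret Q: cdf_distribution Q
    unfolding cdf_distribution_def real_distribution_def real_distribution_axioms_def
    using Q by (simp add: Q_def)
  have "measure P {x} = 0" for x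
  proof -
    have "emeasure lborel (D \<inter> {x}) \<le> emeasure lborel {x}"
      by (intro emeasure_mono) auto
    then show ?thesis
      by (simp add: P_def measure_def)
  qed
  note PC = P.distr_cdf_uniform[OF this]
  \<comment> \<open>The quantile function is only controlled inside the unit interval; the value 0 outside is
    arbitrary and is taken with probability zero.\<close>
  define J where "J \<omega> = (if \<omega> \<in> {0<..<1} then Q.I \<omega> else 0)" for \<omega>
  have [measurable]: "J \<in> borel_measurable borel"
    unfolding J_def
    by (rule measurable_If_restrict_space_iff[THEN iffD2])
      (use Q.measurable_CI in \<open>auto simp: greaterThanLessThan_def greaterThan_def lessThan_def Int_def\<close>)
  define g where "g t = \<phi> (J (P.C t))" for t
  have [measurable]: "g \<in> borel_measurable borel" unfolding g_def by measurable
  have [measurable]: "(\<lambda>x. x) \<in> borel_measurable ?U" "J \<in> borel_measurable ?U"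
    by (auto intro!: measurable_restrict_space1)
  have "distr P borel g = distr (distr P borel P.C) borel (\<lambda>\<omega>. \<phi> (J \<omega>))"
    by (simp add: distr_distr o_def g_def[abs_def])
  also have "\<dots> = distr ?U borel (\<lambda>\<omega>. \<phi> (J \<omega>))"
    unfolding PC by (simp add: distr_distr o_def)
  also have "\<dots> = distr (distr ?U borel J) borel \<phi>"
    by (simp add: distr_distr o_def)
  also have "distr ?U borel J = distr ?U borel Q.I"
    by (intro distr_cong) (auto simp: J_def space_restrict_space)
  also have "\<dots> = Q" by (rule Q.distr_I_eq_M)
  also have "distr Q borel \<phi> = distr m' borel (\<lambda>x. x)"
    unfolding Q_def by (subst distr_distr) (auto simp: o_def \<phi>\<psi>)
  finally have eq: "distr P borel g = distr m' borel (\<lambda>x. x)" .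
  have "emeasure lborel (D \<inter> g -` E) = emeasure m E" if [measurable]: "E \<in> sets borel" for E
  proof -
    have "emeasure P (g -` E) = emeasure (distr P borel g) E"
      by (simp add: emeasure_distr)
    also have "\<dots> = emeasure (distr m' borel (\<lambda>x. x)) E" by (simp only: eq)
    also have "\<dots> = emeasure m' E"
      by (simp add: emeasure_distr sets_eq_imp_space_eq[of m' borel] m'_def m)
    finally have "emeasure P (g -` E) = emeasure m' E" .
    moreover have "g -` E \<in> sets borel" using measurable_sets[of g borel borel E] by simp
    ultimately have "emeasure lborel (D \<inter> g -` E) / emeasure lborel D = emeasure m E / emeasure lborel D"
      by (simp add: P_def m'_def mass m)
    moreover have "x / emeasure lborel D * emeasure lborel D = x" for x
      using False fin by (simp add: ennreal_divide_times ennreal_divide_self)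
    ultimately show ?thesis by metis
  qed
  then show ?thesis by (intro that) auto
qed

text \<open>
  The mass of \<open>A\<close> inside \<open>{-t..t}\<close> is a Lipschitz function of \<open>t\<close> that
  starts at 0 and tends to the mass of \<open>A\<close>, so it takes every intermediate value.
\<close>

lemma borel_subset_of_mass:
  fixes A :: "real set"
  assumes A[measurable]: "A \<in> sets borel" and c: "0 \<le> c" "ennreal c < emeasure lborel A"
  obtains t where "t \<ge> 0" "emeasure lborel (A \<inter> {-t..t}) = ennreal c"
proof -
  define H where "H t = measure lborel (A \<inter> {-t..t})" for t
  have fin: "emeasure lborel (A \<inter> {-t..t}) < \<infinity>" for t
    by (rule le_less_trans[OF emeasure_mono[of _ "{-t..t}"]]) (auto simp: emeasure_lborel_Icc_eq)
  then have H: "emeasure lborel (A \<inter> {-t..t}) = ennreal (H t)" for t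
    unfolding H_def by (intro emeasure_eq_ennreal_measure) (simp add: less_top[symmetric])
  have H_diff: "H t - H s \<le> 2 * (t - s)" "H s \<le> H t" if "0 \<le> s" "s \<le> t" for s t
  proof -
    have "ennreal (H t) \<le> ennreal (H s) + (emeasure lborel {-t..-s} + emeasure lborel {s..t})"
      unfolding H[symmetric] using that
      by (intro order_trans[OF _ order_trans[OF emeasure_subadditive add_left_mono[OF emeasure_subadditive]]]
            emeasure_mono) auto
    also have "\<dots> = ennreal (H s + 2 * (t - s))"
      using that by (simp add: H_def ennreal_plus[symmetric] del: ennreal_plus)
    finally show "H t - H s \<le> 2 * (t - s)"
      using that by (subst (asm) ennreal_le_iff) (auto simp: H_def)
    have "ennreal (H s) \<le> ennreal (H t)"
      unfolding H[symmetric] using that by (intro emeasure_mono) auto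
    then show "H s \<le> H t" by (simp add: H_def)
  qed
  have cont: "continuous_on {0..} H"
  proof (rule continuous_onI)
    fix x e :: real assume "x \<in> {0..}" "0 < e"
    have "dist (H y) (H x) \<le> e" if "y \<in> {0..}" "dist y x < e / 2" for y
      using that \<open>x \<in> {0..}\<close> H_diff[of x y] H_diff[of y x]
      by (cases "x \<le> y") (auto simp: dist_real_def)
    then show "\<exists>d>0. \<forall>x'\<in>{0..}. dist x' x < d \<longrightarrow> dist (H x') (H x) \<le> e"
      using \<open>0 < e\<close> by (intro exI[of _ "e/2"]) auto
  qed
  have "\<exists>n. c < H (real n)"
  proof -
    have "(SUP n. emeasure lborel (A \<inter> {-real n..real n})) = emeasure lborel (\<Union>n. A \<inter> {-real n..real n})"
      by (intro SUP_emeasure_incseq) (auto simp: incseq_def)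
    also have "(\<Union>n. A \<inter> {-real n..real n}) = A"
    proof -
      have "\<exists>n. x \<in> {-real n..real n}" for x
        using real_arch_simple[of "\<bar>x\<bar>"] by (auto simp: abs_le_iff minus_le_iff)
      then show ?thesis by auto
    qed
    finally have "ennreal c < (SUP n. ennreal (H (real n)))" using c unfolding H by simp
    then show ?thesis using c by (auto simp: less_SUP_iff ennreal_less_iff)
  qed
  then obtain n where "c < H (real n)" by blast
  moreover have "H 0 = 0"
  proof -
    have "emeasure lborel (A \<inter> {-0..0}) \<le> emeasure lborel {0::real}"
      by (intro emeasure_mono) auto
    then show ?thesis by (simp add: H_def measure_def)
  qed
  ultimately obtain t where "0 \<le> t" "t \<le> real n" "H t = c"
    using IVT'[of H 0 c "real n"] c(1) continuous_on_subset[OF cont, of "{0..real n}"] by force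
  then show ?thesis using that[of t] H[of t] by simp
qed

text \<open>
  The shells between successive radii \<open>t j\<close> are disjoint. Each of them is given mass \<open>e j +
  1\<close> rather than \<open>e j\<close>: the spare unit makes the radii increase also where \<open>e j =
  0\<close>, and leaves the wanted mass \<open>e j\<close> strictly below the available one when a subset of
  that mass is cut out of the shell.
\<close>

lemma split_infinite_mass:
  fixes Z :: "real set" and e :: "nat \<Rightarrow> real"
  assumes Z[measurable]: "Z \<in> sets borel" and inf: "emeasure lborel Z = \<infinity>" and e: "\<And>j. 0 \<le> e j"
  obtains W where "disjoint_family W" "\<And>j. W j \<in> sets borel" "\<And>j. W j \<subseteq> Z"
    "\<And>j. emeasure lborel (W j) = ennreal (e j)"
proof -
  let ?s = "\<lambda>j. \<Sum>i<j. e i + 1"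
  have s0: "0 \<le> ?s j" for j using e by (intro sum_nonneg) (simp add: add_nonneg_nonneg)
  have "\<exists>t\<ge>0. emeasure lborel (Z \<inter> {-t..t}) = ennreal (?s j)" for j
    using borel_subset_of_mass[OF Z s0[of j]] inf by (metis ennreal_less_top infinity_ennreal_def)
  then obtain t where t: "\<And>j. 0 \<le> t j" "\<And>j. emeasure lborel (Z \<inter> {-t j..t j}) = ennreal (?s j)"
    by metis
  define A where "A j = Z \<inter> {-t j..t j}" for j
  have A: "A j \<in> sets borel" "emeasure lborel (A j) = ennreal (?s j)" for j
    using t by (auto simp: A_def)
  have tS: "t j \<le> t (Suc j)" for j
  proof (rule ccontr)
    assume "\<not> t j \<le> t (Suc j)"
    then have "emeasure lborel (A (Suc j)) \<le> emeasure lborel (A j)"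
      by (intro emeasure_mono) (auto simp: A_def)
    then show False using s0[of j] e[of j] unfolding A by (simp add: ennreal_le_iff)
  qed
  then have sub: "A j \<subseteq> A (Suc j)" for j
    unfolding A_def by (intro Int_mono order_refl) (use tS[of j] in auto)
  let ?Y = "\<lambda>j. A (Suc j) - A j"
  have Y: "emeasure lborel (?Y j) = ennreal (e j + 1)" for j
  proof -
    have "emeasure lborel (?Y j) = emeasure lborel (A (Suc j)) - emeasure lborel (A j)"
      by (intro emeasure_Diff) (use sub A in auto)
    also have "\<dots> = ennreal (e j + 1)"
      using s0[of j] e[of j] unfolding A by (subst ennreal_minus) auto
    finally show ?thesis .
  qed
  have "\<exists>u. emeasure lborel (?Y j \<inter> {-u..u}) = ennreal (e j)" for j
    using borel_subset_of_mass[of "?Y j" "e j"] Y[of j] e[of j] A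
    by (metis ennreal_less_iff less_add_one sets.Diff)
  then obtain u where u: "\<And>j. emeasure lborel (?Y j \<inter> {-u j..u j}) = ennreal (e j)" by metis
  show ?thesis
  proof (rule that[of "\<lambda>j. ?Y j \<inter> {-u j..u j}"])
    have "disjoint_family ?Y"
      by (intro disjoint_family_Suc sub)
    then show "disjoint_family (\<lambda>j. ?Y j \<inter> {-u j..u j})"
      by (auto simp: disjoint_family_on_def)
  qed (use u A A_def in auto)
qed

section \<open>Laws of functions on the line and Levy couplings\<close>

lemma borel_measurable_fst_snd [measurable]:
  "(fst :: 'a::second_countable_topology \<times> 'b::second_countable_topology \<Rightarrow> 'a) \<in> borel_measurable borel"
  "(snd :: 'a::second_countable_topology \<times> 'b::second_countable_topology \<Rightarrow> 'b) \<in> borel_measurable borel"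
  by (intro borel_measurable_continuous_onI continuous_intros)+

text \<open>
  The law of \<open>f\<close> under Lebesgue measure with its mass at the origin deleted. A function on the line
  that represents a Levy measure usually vanishes on a set of infinite measure, and this zero set must not be
  seen.
\<close>

definition levy_law :: "(real \<Rightarrow> 'b::euclidean_space) \<Rightarrow> 'b measure" where
  "levy_law f = distr (density lborel (indicator {t. f t \<noteq> 0})) borel f"

lemma sets_levy_law [simp, measurable_cong]: "sets (levy_law f) = sets borel"
  by (simp add: levy_law_def)

lemma nn_integral_levy_law:
  assumes [measurable]: "f \<in> borel_measurable borel" "h \<in> borel_measurable borel" and "h 0 = 0"
  shows "(\<integral>\<^sup>+ x. h x \<partial>levy_law f) = (\<integral>\<^sup>+ t. h (f t) \<partial>lborel)"
  unfolding levy_law_def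
  by (subst nn_integral_distr, simp, simp, subst nn_integral_density)
     (auto simp: assms(3) indicator_def intro!: nn_integral_cong)

lemma emeasure_levy_law:
  assumes [measurable]: "f \<in> borel_measurable borel" "E \<in> sets borel"
  shows "emeasure (levy_law f) E = emeasure lborel {t. f t \<in> E \<and> f t \<noteq> 0}"
proof -
  have "f -` E \<in> sets borel" using measurable_sets[OF assms] by simp
  then have "emeasure (levy_law f) E = emeasure lborel ({t. f t \<noteq> 0} \<inter> f -` E)"
    unfolding levy_law_def by (subst emeasure_distr) (auto simp: emeasure_restricted)
  also have "{t. f t \<noteq> 0} \<inter> f -` E = {t. f t \<in> E \<and> f t \<noteq> 0}" by auto
  finally show ?thesis .
qed

lemma emeasure_levy_law_vimage:
  assumes "f \<in> borel_measurable borel" "E \<in> sets borel" "0 \<notin> E"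
  shows "emeasure (levy_law f) E = emeasure lborel (f -` E)"
  unfolding emeasure_levy_law[OF assms(1,2)] by (rule arg_cong[where f="emeasure lborel"]) (use assms(3) in auto)

lemma levy_law_eqI:
  assumes f: "f \<in> borel_measurable borel" and \<mu>: "levy_measure \<mu>"
    and eq: "\<And>E. E \<in> sets borel \<Longrightarrow> 0 \<notin> E \<Longrightarrow> emeasure lborel (f -` E) = emeasure \<mu> E"
  shows "levy_law f = \<mu>"
proof (rule measure_eqI)
  have s: "sets \<mu> = sets borel" and z: "emeasure \<mu> {0} = 0" using \<mu> by (auto simp: levy_measure_def)
  then show "sets (levy_law f) = sets \<mu>" by simp
  fix E assume "E \<in> sets (levy_law f)"
  then have E: "E \<in> sets borel" by simp
  have "emeasure (levy_law f) E = emeasure lborel (f -` (E - {0}))"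
    unfolding emeasure_levy_law[OF f E] by (rule arg_cong[where f="emeasure lborel"]) auto
  also have "\<dots> = emeasure \<mu> (E - {0})" using E by (intro eq) auto
  also have "\<dots> = emeasure \<mu> E"
    by (rule emeasure_Diff_null_set) (use E s z in auto)
  finally show "emeasure (levy_law f) E = emeasure \<mu> E" .
qed

lemma levy_law_zero: "f \<in> borel_measurable borel \<Longrightarrow> emeasure (levy_law f) {0} = 0"
  by (auto simp: emeasure_levy_law)

lemma levy_measure_finite_away:
  assumes \<mu>: "levy_measure \<mu>" and E: "E \<in> sets borel" and U: "open U" "0 \<in> U" "E \<inter> U = {}"
  shows "emeasure \<mu> E < \<infinity>"
proof -
  have [measurable_cong]: "sets \<mu> = sets borel" using \<mu> by (simp add: levy_measure_def)
  note [measurable] = E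
  obtain r where r: "0 < r" "ball 0 r \<subseteq> U" using U by (auto simp: open_contains_ball)
  let ?c = "min 1 (r\<^sup>2)"
  have "?c > 0" using r by auto
  have "ennreal ?c * emeasure \<mu> E = (\<integral>\<^sup>+ x. ennreal ?c * indicator E x \<partial>\<mu>)"
    by (subst nn_integral_cmult_indicator) auto
  also have "\<dots> \<le> (\<integral>\<^sup>+ x. ennreal (min 1 ((norm x)\<^sup>2)) \<partial>\<mu>)"
  proof (intro nn_integral_mono)
    fix x
    have "r \<le> norm x" if "x \<in> E"
      using that U r by (metis disjoint_iff dist_0_norm leI mem_ball subset_iff)
    then have "r\<^sup>2 \<le> (norm x)\<^sup>2" if "x \<in> E"
      using that r by (intro power_mono) auto
    then show "ennreal ?c * indicator E x \<le> ennreal (min 1 ((norm x)\<^sup>2))"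
      by (auto simp: indicator_def min_def intro!: ennreal_leI)
  qed
  also have "\<dots> < \<infinity>" using \<mu> by (simp add: levy_measure_def)
  finally show ?thesis
    using \<open>?c > 0\<close> by (auto simp: ennreal_mult_less_top top_unique)
qed

text \<open>
  Couplings prescribe the marginals of sets that stay at a positive distance from the origin. Exhausting a set
  by its parts outside small balls extends this to all Borel sets that merely omit the origin.
\<close>

lemma marginals_off_zero:
  assumes \<gamma>: "\<gamma> \<in> levy_couplings \<mu> \<nu>" and \<mu>: "levy_measure \<mu>" and \<nu>: "levy_measure \<nu>"
    and E: "E \<in> sets borel" "0 \<notin> (E :: 'a::euclidean_space set)"
  shows "emeasure \<gamma> (E \<times> UNIV) = emeasure \<mu> E" "emeasure \<gamma> (UNIV \<times> E) = emeasure \<nu> E"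
proof -
  have s: "sets \<gamma> = sets borel" "sets \<mu> = sets borel" "sets \<nu> = sets borel"
    using \<gamma> \<mu> \<nu> by (auto simp: levy_couplings_def levy_measure_def)
  let ?E = "\<lambda>k. E - ball 0 (1 / real (Suc k))"
  have inc: "incseq ?E"
    unfolding incseq_Suc_iff by (intro allI Diff_mono order_refl subset_ball) (simp add: frac_le)
  have U: "(\<Union>k. ?E k) = E"
  proof -
    have "\<exists>k. x \<notin> ball 0 (1 / real (Suc k))" if "x \<in> E" for x
    proof -
      have "0 < norm x" using that E(2) by auto
      from reals_Archimedean[OF this] show ?thesis by (auto simp: inverse_eq_divide not_less intro: less_imp_le)
    qed
    then show ?thesis by blast
  qed
  have Ek: "?E k \<in> sets borel" for k using E by auto
  have eq: "emeasure \<gamma> (?E k \<times> UNIV) = emeasure \<mu> (?E k) \<and> emeasure \<gamma> (UNIV \<times> ?E k) = emeasure \<nu> (?E k)" for k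
    using \<gamma> Ek[of k] unfolding levy_couplings_def
    by (auto intro!: exI[of _ "ball 0 (1 / real (Suc k))"])
  have p: "?E k \<times> UNIV \<in> sets borel" "UNIV \<times> ?E k \<in> sets borel" for k
    using Ek by (auto intro!: borel_Times)
  have inc2: "incseq (\<lambda>k. ?E k \<times> (UNIV :: 'a set))" "incseq (\<lambda>k. (UNIV :: 'a set) \<times> ?E k)"
    using inc unfolding incseq_def by blast+
  have "emeasure \<gamma> (E \<times> UNIV) = emeasure \<gamma> (\<Union>k. ?E k \<times> UNIV)"
    by (rule arg_cong[where f="emeasure \<gamma>"]) (use U in blast)
  also have "\<dots> = (SUP k. emeasure \<gamma> (?E k \<times> UNIV))"
    by (intro SUP_emeasure_incseq[symmetric]) (use p s inc2 in auto)
  also have "\<dots> = (SUP k. emeasure \<mu> (?E k))" using eq by simp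
  also have "\<dots> = emeasure \<mu> (\<Union>k. ?E k)"
    by (intro SUP_emeasure_incseq) (use Ek s inc in auto)
  finally show "emeasure \<gamma> (E \<times> UNIV) = emeasure \<mu> E" unfolding U .
  have "emeasure \<gamma> (UNIV \<times> E) = emeasure \<gamma> (\<Union>k. UNIV \<times> ?E k)"
    by (rule arg_cong[where f="emeasure \<gamma>"]) (use U in blast)
  also have "\<dots> = (SUP k. emeasure \<gamma> (UNIV \<times> ?E k))"
    by (intro SUP_emeasure_incseq[symmetric]) (use p s inc2 in auto)
  also have "\<dots> = (SUP k. emeasure \<nu> (?E k))" using eq by simp
  also have "\<dots> = emeasure \<nu> (\<Union>k. ?E k)"
    by (intro SUP_emeasure_incseq) (use Ek s inc in auto)
  finally show "emeasure \<gamma> (UNIV \<times> E) = emeasure \<nu> E" unfolding U .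
qed

text \<open>
  Two functions on a common domain couple their laws through the law of the pair. Points where exactly one of
  the two vanishes give mass on a coordinate subspace \<open>E \<times> {0}\<close> or \<open>{0} \<times>
  E\<close>, which is how a Levy coupling exchanges mass with the origin.
\<close>

lemma coupling_of_levy_laws:
  fixes f g :: "real \<Rightarrow> 'a::euclidean_space"
  assumes f[measurable]: "f \<in> borel_measurable borel" and g[measurable]: "g \<in> borel_measurable borel"
    and lf: "levy_measure (levy_law f)" and lg: "levy_measure (levy_law g)"
  shows "levy_law (\<lambda>t. (f t, g t)) \<in> levy_couplings (levy_law f) (levy_law g)"
proof -
  let ?h = "\<lambda>t. (f t, g t)"
  have h[measurable]: "?h \<in> borel_measurable borel" by simp
  have "(\<integral>\<^sup>+ z. ennreal (min 1 ((norm z)\<^sup>2)) \<partial>levy_law ?h)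
      = (\<integral>\<^sup>+ t. ennreal (min 1 ((norm (?h t))\<^sup>2)) \<partial>lborel)"
    by (subst nn_integral_levy_law) auto
  also have "\<dots> \<le> (\<integral>\<^sup>+ t. ennreal (min 1 ((norm (f t))\<^sup>2)) + ennreal (min 1 ((norm (g t))\<^sup>2)) \<partial>lborel)"
  proof (intro nn_integral_mono)
    fix t
    have "min 1 (a + b) \<le> min 1 a + min 1 b" if "0 \<le> a" "0 \<le> b" for a b :: real
      using that by (auto simp: min_def)
    from this[OF zero_le_power2 zero_le_power2, of "norm (f t)" "norm (g t)"]
    show "ennreal (min 1 ((norm (?h t))\<^sup>2)) \<le> ennreal (min 1 ((norm (f t))\<^sup>2)) + ennreal (min 1 ((norm (g t))\<^sup>2))"
      by (simp add: norm_Pair ennreal_plus[symmetric] ennreal_leI del: ennreal_plus)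
  qed
  also have "\<dots> = (\<integral>\<^sup>+ x. ennreal (min 1 ((norm x)\<^sup>2)) \<partial>levy_law f) + (\<integral>\<^sup>+ x. ennreal (min 1 ((norm x)\<^sup>2)) \<partial>levy_law g)"
    by (subst nn_integral_add) (auto simp: nn_integral_levy_law)
  also have "\<dots> < \<infinity>" using lf lg by (auto simp: levy_measure_def)
  finally have "levy_measure (levy_law ?h)"
    by (auto simp: levy_measure_def levy_law_zero[OF h, unfolded zero_prod_def] zero_prod_def)
  moreover have "emeasure (levy_law ?h) (E \<times> UNIV) = emeasure (levy_law f) E
      \<and> emeasure (levy_law ?h) (UNIV \<times> E) = emeasure (levy_law g) E"
    if E: "E \<in> sets borel" "0 \<notin> E" for E
  proof -
    have "E \<times> UNIV \<in> sets borel" "UNIV \<times> E \<in> sets borel" using E by (auto intro!: borel_Times)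
    moreover have "0 \<notin> E \<times> UNIV" "0 \<notin> UNIV \<times> E" using E by (auto simp: zero_prod_def)
    ultimately have "emeasure (levy_law ?h) (E \<times> UNIV) = emeasure lborel (?h -` (E \<times> UNIV))"
      "emeasure (levy_law ?h) (UNIV \<times> E) = emeasure lborel (?h -` (UNIV \<times> E))"
      using emeasure_levy_law_vimage[OF h] by blast+
    moreover have "?h -` (E \<times> UNIV) = f -` E" "?h -` (UNIV \<times> E) = g -` E" by auto
    ultimately show ?thesis
      using emeasure_levy_law_vimage[OF f E] emeasure_levy_law_vimage[OF g E] by metis
  qed
  ultimately show ?thesis
    unfolding levy_couplings_def by auto
qed

lemma levy_cost2_le_L2:
  fixes f g :: "real \<Rightarrow> 'a::euclidean_space"
  assumes [measurable]: "f \<in> borel_measurable borel" "g \<in> borel_measurable borel"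
    and "levy_measure (levy_law f)" "levy_measure (levy_law g)"
  shows "levy_cost2 (levy_law f) (levy_law g) \<le> (\<integral>\<^sup>+ t. ennreal (1 / 2 * (norm (f t - g t))\<^sup>2) \<partial>lborel)"
proof -
  have "levy_cost2 (levy_law f) (levy_law g)
      \<le> (\<integral>\<^sup>+ (x, y). ennreal (1 / 2 * (norm (x - y))\<^sup>2) \<partial>levy_law (\<lambda>t. (f t, g t)))"
    unfolding levy_cost2_def by (intro INF_lower coupling_of_levy_laws assms)
  also have "\<dots> = (\<integral>\<^sup>+ t. ennreal (1 / 2 * (norm (f t - g t))\<^sup>2) \<partial>lborel)"
    unfolding case_prod_beta' by (subst nn_integral_levy_law) (auto simp: zero_prod_def)
  finally show ?thesis .
qed

lemma nn_integral_marginal: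
  fixes \<mu> \<nu> :: "'a::euclidean_space measure"
  assumes \<gamma>: "\<gamma> \<in> levy_couplings \<mu> \<nu>" and \<mu>: "levy_measure \<mu>" and \<nu>: "levy_measure \<nu>"
    and h[measurable]: "h \<in> borel_measurable borel" and h0: "h 0 = 0"
  shows "(\<integral>\<^sup>+ z. h (fst z) \<partial>\<gamma>) = (\<integral>\<^sup>+ x. h x \<partial>\<mu>)"
proof -
  have s[measurable_cong]: "sets \<gamma> = sets borel" "sets \<mu> = sets borel"
    and z: "emeasure \<mu> {0} = 0"
    using \<gamma> \<mu> \<nu> by (auto simp: levy_couplings_def levy_measure_def)
  have sp: "space \<gamma> = UNIV" using sets_eq_imp_space_eq[OF s(1)] by simp
  have "distr (density \<gamma> (indicator {z. fst z \<noteq> 0})) borel fst = \<mu>"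
  proof (rule measure_eqI)
    fix E :: "'a set" assume "E \<in> sets (distr (density \<gamma> (indicator {z. fst z \<noteq> 0})) borel fst)"
    then have E[measurable]: "E \<in> sets borel" by simp
    have "emeasure (distr (density \<gamma> (indicator {z. fst z \<noteq> 0})) borel fst) E = emeasure \<gamma> ((E - {0}) \<times> UNIV)"
    proof -
      have *: "fst -` E \<in> sets \<gamma>" "{z. fst z \<noteq> 0} \<in> sets \<gamma>"
        using measurable_sets[of fst \<gamma> borel E] measurable_sets[of fst \<gamma> borel "- {0}"]
          measurable_cong_sets[OF s(1) refl, of borel] borel_measurable_fst_snd(1)
        by (auto simp: sp vimage_def)
      then have "emeasure (distr (density \<gamma> (indicator {z. fst z \<noteq> 0})) borel fst) E
          = emeasure \<gamma> ({z. fst z \<noteq> 0} \<inter> fst -` E)"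
        by (subst emeasure_distr) (auto simp: emeasure_restricted sp)
      also have "{z. fst z \<noteq> 0} \<inter> fst -` E = (E - {0}) \<times> UNIV" by auto
      finally show ?thesis .
    qed
    also have "\<dots> = emeasure \<mu> (E - {0})"
      by (intro marginals_off_zero[OF \<gamma> \<mu> \<nu>]) auto
    also have "\<dots> = emeasure \<mu> E"
      by (rule emeasure_Diff_null_set) (use E s z in auto)
    finally show "emeasure (distr (density \<gamma> (indicator {z. fst z \<noteq> 0})) borel fst) E = emeasure \<mu> E" .
  qed (simp add: s)
  then have "(\<integral>\<^sup>+ x. h x \<partial>\<mu>) = (\<integral>\<^sup>+ x. h x \<partial>distr (density \<gamma> (indicator {z. fst z \<noteq> 0})) borel fst)"
    by simp
  also have "\<dots> = (\<integral>\<^sup>+ z. h (fst z) \<partial>\<gamma>)"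
    by (subst nn_integral_distr, simp, simp, subst nn_integral_density)
      (auto simp: h0 indicator_def intro!: nn_integral_cong)
  finally show ?thesis ..
qed

section \<open>Lifting a coupling to the line\<close>

text \<open>
  A substitute for Minkowski's inequality that can be applied pointwise under an integral: for small
  \<open>s\<close> the first summand is hardly enlarged, and for \<open>s\<close> equal to the ratio of the
  second to the first \<open>L\<^sup>2\<close> norm the triangle inequality in \<open>L\<^sup>2\<close> results.
\<close>

lemma norm_add_sq_le_weighted:
  fixes a b :: "'a::real_normed_vector"
  assumes s: "0 < s"
  shows "(norm (a + b))\<^sup>2 \<le> (1 + s) * (norm a)\<^sup>2 + (1 + 1 / s) * (norm b)\<^sup>2"
proof -
  have "0 \<le> (s * norm a - norm b)\<^sup>2 / s" using s by simp
  then have "2 * norm a * norm b \<le> s * (norm a)\<^sup>2 + (norm b)\<^sup>2 / s"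
    using s by (simp add: power2_eq_square field_simps)
  moreover have "(norm (a + b))\<^sup>2 \<le> (norm a + norm b)\<^sup>2"
    by (intro power_mono norm_triangle_ineq) auto
  ultimately show ?thesis by (simp add: power2_sum algebra_simps)
qed

text \<open>
  Rounding with an error proportional to \<open>norm x\<close> has two merits: the squared error is bounded by
  \<open>\<epsilon>\<^sup>2 * (norm x)\<^sup>2\<close>, which is integrable for measures with finite second
  moment, and every cell stays away from the origin, so that Levy measures give it finite mass.
\<close>

lemma relative_quantisation:
  fixes \<epsilon> :: real and d :: "nat \<Rightarrow> 'a::euclidean_space"
  assumes \<epsilon>: "0 < \<epsilon>" "\<epsilon> < 1"
    and d0: "d 0 = 0" and dense: "\<And>X. open X \<Longrightarrow> X \<noteq> {} \<Longrightarrow> \<exists>n. d n \<in> X"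
  obtains q :: "'a \<Rightarrow> nat"
  where "q \<in> measurable borel (count_space UNIV)" "\<And>x. norm (x - d (q x)) \<le> \<epsilon> * norm x"
    "\<And>n. \<exists>r>0. \<forall>x. x \<noteq> 0 \<and> q x = n \<longrightarrow> r \<le> norm x"
proof -
  have ex: "\<exists>n. norm (x - d n) \<le> \<epsilon> * norm x" for x
  proof (cases "x = 0")
    case True
    then show ?thesis using d0 by (intro exI[of _ 0]) simp
  next
    case False
    then have "x \<in> ball x (\<epsilon> * norm x)" using \<epsilon> by simp
    then obtain n where "d n \<in> ball x (\<epsilon> * norm x)"
      using dense[OF open_ball, of x "\<epsilon> * norm x"] by blast
    then show ?thesis by (intro exI[of _ n]) (simp add: dist_norm)
  qed
  define q where "q x = (LEAST n. norm (x - d n) \<le> \<epsilon> * norm x)" for x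
  have q: "norm (x - d (q x)) \<le> \<epsilon> * norm x" for x
    unfolding q_def using LeastI_ex[OF ex] .
  show ?thesis
  proof (rule that[OF _ q])
    show "q \<in> measurable borel (count_space UNIV)"
      unfolding q_def by measurable
    fix n
    have "norm (d n) / 2 \<le> norm x" if "q x = n" for x
    proof -
      have "norm (d n) \<le> norm x + norm (x - d n)"
        by (metis norm_minus_commute norm_triangle_sub)
      also have "\<dots> \<le> norm x + \<epsilon> * norm x" using q[of x] that by simp
      also have "\<epsilon> * norm x \<le> 1 * norm x" using \<epsilon> by (intro mult_right_mono) auto
      finally show ?thesis by simp
    qed
    moreover have "x = 0" if "q x = n" "d n = 0" for x
    proof (rule ccontr)
      assume "x \<noteq> 0"
      then have "\<epsilon> * norm x < 1 * norm x" using \<epsilon> by (intro mult_strict_right_mono) auto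
      then show False using q[of x] that by simp
    qed
    ultimately show "\<exists>r>0. \<forall>x. x \<noteq> 0 \<and> q x = n \<longrightarrow> r \<le> norm x"
      by (cases "d n = 0") (auto intro!: exI[of _ "if d n = 0 then 1 else norm (d n) / 2"])
  qed
qed

lemma paste_along_disjoint_family:
  fixes D :: "nat \<Rightarrow> real set" and g :: "nat \<Rightarrow> real \<Rightarrow> 'a::euclidean_space"
  assumes D: "disjoint_family D" "\<And>j. D j \<in> sets borel" and g: "\<And>j. g j \<in> borel_measurable borel"
  shows "\<exists>h. h \<in> borel_measurable borel \<and> (\<forall>j. \<forall>t\<in>D j. h t = g j t)
    \<and> (\<forall>t. t \<notin> (\<Union>j. D j) \<longrightarrow> h t = 0)"
proof -
  note [measurable] = D(2) g
  define J where "J t = (LEAST j. t \<in> D j)" for t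
  have [measurable]: "J \<in> measurable borel (count_space UNIV)"
    unfolding J_def by measurable
  have J: "J t = j" if "t \<in> D j" for t j
  proof -
    have "t \<in> D (J t)" unfolding J_def by (rule LeastI[of _ j]) (rule that)
    then show ?thesis using that disjoint_family_onD[OF D(1), of "J t" j] by blast
  qed
  define h where "h t = (if t \<in> (\<Union>j. D j) then g (J t) t else 0)" for t
  have "(\<lambda>t. g (J t) t) \<in> borel_measurable borel"
    by (rule measurable_compose_countable[where f="\<lambda>j t. g j t"]) measurable
  then have "h \<in> borel_measurable borel"
    unfolding h_def by measurable
  then show ?thesis by (intro exI[of _ h]) (auto simp: h_def J)
qed

text \<open>
  First \<open>s\<close> is chosen so small that \<open>(1 + s)\<^sup>2 * C\<close> stays below the midpoint of
  \<open>C\<close> and \<open>c\<close>. The remaining terms carry the factor \<open>1 / s\<close>, but also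
  \<open>\<epsilon>\<^sup>2\<close>, and fit into the other half once \<open>\<epsilon>\<close> is small.
\<close>

lemma lift_constants:
  fixes C c M :: real
  assumes "0 \<le> C" "C < c" "0 \<le> M"
  obtains s \<epsilon> where "0 < s" "0 < \<epsilon>" "\<epsilon> < 1"
    "(1 + s) * ((1 + s) * C + (1 + 1 / s) * (\<epsilon>\<^sup>2 * M)) + (1 + 1 / s) * (\<epsilon>\<^sup>2 * M) \<le> c"
proof -
  define s where "s = min 1 ((c - C) / (6 * (C + 1)))"
  have "s * (6 * (C + 1)) \<le> (c - C) / (6 * (C + 1)) * (6 * (C + 1))"
    using assms by (intro mult_right_mono) (auto simp: s_def)
  moreover have "(c - C) / (6 * (C + 1)) * (6 * (C + 1)) = c - C"
    using assms by simp
  ultimately have s: "0 < s" "s \<le> 1" "s * (6 * (C + 1)) \<le> c - C"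
    using assms by (auto simp: s_def)
  have "s * s \<le> s" using s mult_left_le[of s s] by simp
  then have "(1 + s) * ((1 + s) * C) \<le> (1 + 3 * s) * C"
    using mult_right_mono[of "s * s" s C] assms(1) by (simp add: algebra_simps)
  also have "\<dots> \<le> C + (c - C) / 2"
    using s by (simp add: algebra_simps)
  finally have 1: "(1 + s) * ((1 + s) * C) \<le> C + (c - C) / 2" .
  define K where "K = ((1 + s) * (1 + 1 / s) + (1 + 1 / s)) * M"
  have K: "0 \<le> K" unfolding K_def using s assms by (intro mult_nonneg_nonneg add_nonneg_nonneg) auto
  define \<epsilon> where "\<epsilon> = min (1/2) ((c - C) / (2 * (K + 1)))"
  have "\<epsilon> * (2 * (K + 1)) \<le> (c - C) / (2 * (K + 1)) * (2 * (K + 1))"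
    using K by (intro mult_right_mono) (auto simp: \<epsilon>_def)
  moreover have "(c - C) / (2 * (K + 1)) * (2 * (K + 1)) = c - C"
    using K by simp
  ultimately have e: "0 < \<epsilon>" "\<epsilon> < 1" "\<epsilon> * (2 * (K + 1)) \<le> c - C"
    using assms K by (auto simp: \<epsilon>_def)
  have "\<epsilon>\<^sup>2 * K \<le> \<epsilon> * K"
    using e K by (intro mult_right_mono) (auto simp: power2_eq_square mult_left_le)
  also have "\<dots> \<le> (c - C) / 2" using e by (simp add: algebra_simps)
  finally have "\<epsilon>\<^sup>2 * K \<le> (c - C) / 2" .
  moreover have "(1 + s) * ((1 + s) * C + (1 + 1 / s) * (\<epsilon>\<^sup>2 * M)) + (1 + 1 / s) * (\<epsilon>\<^sup>2 * M)
      = (1 + s) * ((1 + s) * C) + \<epsilon>\<^sup>2 * K"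
    by (simp add: K_def algebra_simps)
  ultimately have "(1 + s) * ((1 + s) * C + (1 + 1 / s) * (\<epsilon>\<^sup>2 * M)) + (1 + 1 / s) * (\<epsilon>\<^sup>2 * M) \<le> c"
    using add_mono[OF 1 \<open>\<epsilon>\<^sup>2 * K \<le> (c - C) / 2\<close>] by (simp add: field_sum_of_halves)
  then show ?thesis using s e by (intro that[of s \<epsilon>])
qed

text \<open>
  The hypothesis says that \<open>g\<close> has on the piece \<open>D\<close> the same law as the second
  coordinate has on the part \<open>K\<close> of the coupling; integrals of functions of that coordinate can
  then be moved from one to the other.
\<close>

lemma nn_integral_on_piece:
  fixes g :: "real \<Rightarrow> 'a::euclidean_space" and \<gamma> :: "('a \<times> 'a) measure"
  assumes D[measurable]: "D \<in> sets borel" and g[measurable]: "g \<in> borel_measurable borel"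
    and s[measurable_cong]: "sets \<gamma> = sets borel" and K[measurable]: "K \<in> sets borel"
    and eq: "\<And>E. E \<in> sets borel \<Longrightarrow> emeasure lborel (D \<inter> g -` E) = emeasure \<gamma> (K \<inter> snd -` E)"
    and h[measurable]: "h \<in> borel_measurable borel"
  shows "(\<integral>\<^sup>+ t. h (g t) * indicator D t \<partial>lborel) = (\<integral>\<^sup>+ z. h (snd z) * indicator K z \<partial>\<gamma>)"
proof -
  have sp: "space \<gamma> = UNIV" using sets_eq_imp_space_eq[OF s] by simp
  have "distr (density lborel (indicator D)) borel g = distr (density \<gamma> (indicator K)) borel snd"
  proof (rule measure_eqI)
    fix E :: "'a set" assume "E \<in> sets (distr (density lborel (indicator D)) borel g)"
    then have E[measurable]: "E \<in> sets borel" by simp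
    have m: "g -` E \<in> sets borel" "snd -` E \<in> sets \<gamma>"
      using measurable_sets[OF g E] measurable_sets[OF borel_measurable_fst_snd(2) E] s by auto
    show "emeasure (distr (density lborel (indicator D)) borel g) E = emeasure (distr (density \<gamma> (indicator K)) borel snd) E"
      using m eq[OF E] K s by (subst (1 2) emeasure_distr) (auto simp: emeasure_restricted sp)
  qed simp
  then have "(\<integral>\<^sup>+ x. h x \<partial>distr (density lborel (indicator D)) borel g)
    = (\<integral>\<^sup>+ x. h x \<partial>distr (density \<gamma> (indicator K)) borel snd)" by simp
  then show ?thesis
    by (simp add: nn_integral_distr nn_integral_density mult.commute)
qed

text \<open>
  The key step: if \<open>\<mu>\<close> is already represented by a function \<open>f\<close>, then any coupling
  \<open>\<gamma>\<close> of \<open>\<mu>\<close> and \<open>\<nu>\<close> can be imitated by a function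
  \<open>g\<close> on the same line which has law \<open>\<nu>\<close> exactly, and whose squared distance to
  \<open>f\<close> exceeds the integral of the squared displacement under \<open>\<gamma>\<close> by as little
  as desired. Discretising the first coordinate takes the place of a disintegration of \<open>\<gamma>\<close>.
  The part of \<open>\<gamma>\<close> whose first coordinate lies in a cell \<open>B n\<close> off the origin is
  finite and has the mass of the set where \<open>f\<close> lies in \<open>B n\<close>; on that set
  \<open>g\<close> receives the law of the second coordinate. Within a cell the first coordinate is nearly
  constant, so replacing it by the centre of the cell costs little, once for \<open>f\<close> and once for
  \<open>\<gamma>\<close>.

  The part of \<open>\<gamma>\<close> on \<open>{0} \<times> UNIV\<close> describes mass that is created at the
  origin. It may be infinite and is cut into finite parts according to the cell of the second coordinate; these
  are realised on disjoint subsets of the zero set of \<open>f\<close>. This is what the infinite zero set is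
  for, and enough of it is left over for \<open>g\<close> to have an infinite zero set as well, so that the
  construction can be repeated.
\<close>

theorem lift_coupling:
  fixes f :: "real \<Rightarrow> 'a::euclidean_space" and \<mu> \<nu> :: "'a measure"
  assumes f[measurable]: "f \<in> borel_measurable borel" and law: "levy_law f = \<mu>"
    and room: "emeasure lborel {t. f t = 0} = \<infinity>"
    and \<mu>: "\<mu> \<in> \<Lambda>\<^sub>2" and \<nu>: "levy_measure \<nu>" and \<gamma>: "\<gamma> \<in> levy_couplings \<mu> \<nu>"
    and cost: "(\<integral>\<^sup>+ z. ennreal ((norm (fst z - snd z))\<^sup>2) \<partial>\<gamma>) < ennreal c"
  obtains g where "g \<in> borel_measurable borel" "levy_law g = \<nu>" "emeasure lborel {t. g t = 0} = \<infinity>"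
    "(\<integral>\<^sup>+ t. ennreal ((norm (f t - g t))\<^sup>2) \<partial>lborel) \<le> ennreal c"
proof -
  have \<mu>L: "levy_measure \<mu>" and \<mu>2: "(\<integral>\<^sup>+ x. ennreal ((norm x)\<^sup>2) \<partial>\<mu>) < \<infinity>"
    using \<mu> by (auto simp: levy_measures2_def)
  have s\<gamma>[measurable_cong]: "sets \<gamma> = sets borel" and \<gamma>0: "emeasure \<gamma> {0} = 0"
    using \<gamma> by (auto simp: levy_couplings_def levy_measure_def)
  have sp\<gamma>: "space \<gamma> = UNIV" using sets_eq_imp_space_eq[OF s\<gamma>] by simp
  define C where "C = enn2real (\<integral>\<^sup>+ z. ennreal ((norm (fst z - snd z))\<^sup>2) \<partial>\<gamma>)"
  define M where "M = enn2real (\<integral>\<^sup>+ x. ennreal ((norm x)\<^sup>2) \<partial>\<mu>)"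
  have C: "(\<integral>\<^sup>+ z. ennreal ((norm (fst z - snd z))\<^sup>2) \<partial>\<gamma>) = ennreal C"
    unfolding C_def using cost by (subst ennreal_enn2real) (auto intro: less_trans)
  have M: "(\<integral>\<^sup>+ x. ennreal ((norm x)\<^sup>2) \<partial>\<mu>) = ennreal M"
    unfolding M_def using \<mu>2 by (subst ennreal_enn2real) auto
  have Mf: "(\<integral>\<^sup>+ t. ennreal ((norm (f t))\<^sup>2) \<partial>lborel) = ennreal M"
    unfolding M[symmetric] law[symmetric] by (subst nn_integral_levy_law) auto
  have M\<gamma>: "(\<integral>\<^sup>+ z. ennreal ((norm (fst z))\<^sup>2) \<partial>\<gamma>) = ennreal M"
    unfolding M[symmetric] using nn_integral_marginal[OF \<gamma> \<mu>L \<nu>, of "\<lambda>x. ennreal ((norm x)\<^sup>2)"] by simp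
  have C0: "0 \<le> C" "C < c" "0 \<le> M"
    using cost unfolding C by (auto simp: C_def M_def ennreal_less_iff)
  obtain s \<epsilon> where s: "0 < s" and \<epsilon>: "0 < \<epsilon>" "\<epsilon> < 1" and
    bound: "(1 + s) * ((1 + s) * C + (1 + 1 / s) * (\<epsilon>\<^sup>2 * M)) + (1 + 1 / s) * (\<epsilon>\<^sup>2 * M) \<le> c"
    using lift_constants[OF C0] by metis
  obtain d :: "nat \<Rightarrow> 'a" where d: "d 0 = 0" "\<And>X. open X \<Longrightarrow> X \<noteq> {} \<Longrightarrow> \<exists>n. d n \<in> X"
    using dense_sequence_starting_at_zero by metis
  obtain q where q[measurable]: "q \<in> measurable borel (count_space UNIV)"
    and dq: "\<And>x. norm (x - d (q x)) \<le> \<epsilon> * norm x"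
    and away: "\<And>n. \<exists>r>0. \<forall>x. x \<noteq> 0 \<and> q x = n \<longrightarrow> r \<le> norm x"
    using relative_quantisation[OF \<epsilon> d] by metis
  define B where "B n = {x. x \<noteq> 0 \<and> q x = n}" for n
  have B[measurable]: "B n \<in> sets borel" for n unfolding B_def by measurable
  have B0: "0 \<notin> B n" for n by (simp add: B_def)
  have Bfin: "emeasure \<rho> (B n) < \<infinity>" if "levy_measure \<rho>" for \<rho> n
  proof -
    obtain r where "0 < r" "\<forall>x. x \<noteq> 0 \<and> q x = n \<longrightarrow> r \<le> norm x" using away by blast
    then show ?thesis
      by (intro levy_measure_finite_away[OF that B, of "ball 0 r"]) (auto simp: B_def not_less[symmetric])
  qed
  \<comment> \<open>Even indices are the cells of a nonzero first coordinate, odd ones the cells of the second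
    coordinate where the first one vanishes.\<close>
  define code where "code z = (if fst z \<noteq> 0 then 2 * q (fst z) else 2 * q (snd z) + 1)" for z
  define K where "K j = {z. z \<noteq> 0 \<and> code z = j}" for j
  have [measurable]: "code \<in> measurable borel (count_space UNIV)"
    unfolding code_def by measurable
  have K[measurable]: "K j \<in> sets borel" for j unfolding K_def by measurable
  have Keven: "K (2 * n) = B n \<times> UNIV" for n
    by (auto simp: K_def code_def B_def zero_prod_def Suc_double_not_eq_double double_not_eq_Suc_double split: if_splits)
  have Kodd: "K (2 * n + 1) \<subseteq> UNIV \<times> B n" for n
    by (auto simp: K_def code_def B_def zero_prod_def Suc_double_not_eq_double double_not_eq_Suc_double split: if_splits)
  have Keven_mass: "emeasure \<gamma> (K (2 * n)) = emeasure \<mu> (B n)" for n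
    unfolding Keven by (intro marginals_off_zero[OF \<gamma> \<mu>L \<nu>] B B0)
  have Kfin: "emeasure \<gamma> (K j) < \<infinity>" for j
  proof (cases "even j")
    case True
    then show ?thesis using Keven_mass Bfin[OF \<mu>L] by (metis evenE)
  next
    case False
    then obtain n where j: "j = 2 * n + 1" by (metis oddE)
    have "emeasure \<gamma> (K j) \<le> emeasure \<gamma> (UNIV \<times> B n)"
      unfolding j using Kodd s\<gamma> by (intro emeasure_mono) (auto intro!: borel_Times)
    also have "\<dots> = emeasure \<nu> (B n)"
      by (intro marginals_off_zero[OF \<gamma> \<mu>L \<nu>] B B0)
    finally show ?thesis using Bfin[OF \<nu>] by (metis order_le_less_trans)
  qed
  have Zm: "{t. f t = 0} \<in> sets borel" by measurable
  \<comment> \<open>Only the even-numbered reserved sets are used; the odd-numbered ones, each of mass 1,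
    will lie in the zero set of \<open>g\<close>.\<close>
  define w where "w i = (if even i then measure \<gamma> (K (i + 1)) else 1)" for i
  obtain W where W: "disjoint_family W" "\<And>i. W i \<in> sets borel" "\<And>i. W i \<subseteq> {t. f t = 0}"
      "\<And>i. emeasure lborel (W i) = ennreal (w i)"
  proof -
    have "0 \<le> w i" for i by (simp add: w_def)
    then show ?thesis using split_infinite_mass[OF Zm room, of w] that by metis
  qed
  define D where "D j = (if even j then f -` B (j div 2) else W (j - 1))" for j
  have D[measurable]: "D j \<in> sets borel" for j
    unfolding D_def using W(2) measurable_sets[OF f B] by auto
  have Ddisj: "disjoint_family D"
    unfolding disjoint_family_on_def
  proof (intro ballI impI)
    fix i j :: nat assume ij: "i \<noteq> j"
    have "f t \<noteq> 0 \<and> i = 2 * q (f t) \<or> f t = 0 \<and> odd i \<and> t \<in> W (i - 1)" if "t \<in> D i" for t i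
      using that W(3)[of "i - 1"] by (auto simp: D_def B_def split: if_splits)
    note * = this
    have False if "t \<in> D i" "t \<in> D j" for t
    proof -
      have "odd i" "odd j" "t \<in> W (i - 1)" "t \<in> W (j - 1)"
        using *[OF that(1)] *[OF that(2)] ij by auto
      moreover then have "i - 1 \<noteq> j - 1" using ij by (metis odd_pos Suc_pred' One_nat_def)
      ultimately show False using W(1) unfolding disjoint_family_on_def by blast
    qed
    then show "D i \<inter> D j = {}" by blast
  qed
  have Dmass: "emeasure lborel (D j) = emeasure \<gamma> (K j)" for j
  proof (cases "even j")
    case True
    then obtain n where j: "j = 2 * n" by (metis evenE)
    have "emeasure lborel (D j) = emeasure \<mu> (B n)"
      unfolding law[symmetric] emeasure_levy_law_vimage[OF f B B0] by (simp add: D_def j)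
    then show ?thesis unfolding j Keven_mass .
  next
    case False
    then have "emeasure lborel (D j) = ennreal (measure \<gamma> (K j))"
      by (simp add: D_def W(4) w_def odd_pos)
    also have "\<dots> = emeasure \<gamma> (K j)"
      using Kfin[of j] by (intro emeasure_eq_ennreal_measure[symmetric]) auto
    finally show ?thesis .
  qed
  have "\<exists>g :: real \<Rightarrow> 'a. g \<in> borel_measurable borel \<and>
      (\<forall>E\<in>sets borel. emeasure lborel (D j \<inter> g -` E) = emeasure \<gamma> (K j \<inter> snd -` E))" for j
  proof -
    let ?m = "distr (density \<gamma> (indicator (K j))) borel snd"
    have m: "emeasure ?m E = emeasure \<gamma> (K j \<inter> snd -` E)" if E: "E \<in> sets borel" for E
    proof -
      have "snd -` E \<in> sets \<gamma>" using measurable_sets[OF borel_measurable_fst_snd(2) E] s\<gamma> by auto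
      then show ?thesis
        using E K s\<gamma> by (subst emeasure_distr) (auto simp: emeasure_restricted sp\<gamma>)
    qed
    have "emeasure lborel (D j) < \<infinity>" using Dmass Kfin by metis
    moreover have "emeasure ?m UNIV = emeasure lborel (D j)" using m[of UNIV] Dmass by simp
    ultimately show ?thesis
      using realise_finite_measure_on_line[OF D, of j ?m] m by (metis sets_distr)
  qed
  then obtain g' where g'[measurable]: "\<And>j. g' j \<in> borel_measurable borel"
    and g'_law: "\<And>j E. E \<in> sets borel \<Longrightarrow> emeasure lborel (D j \<inter> g' j -` E) = emeasure \<gamma> (K j \<inter> snd -` E)"
    by metis
  obtain g where g[measurable]: "g \<in> borel_measurable borel" and gD: "\<And>j t. t \<in> D j \<Longrightarrow> g t = g' j t"
    and g0: "\<And>t. t \<notin> (\<Union>j. D j) \<Longrightarrow> g t = 0"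
    using paste_along_disjoint_family[where D=D and g=g', OF Ddisj D g'] by blast
  have g_law: "emeasure lborel (D j \<inter> g -` E) = emeasure \<gamma> (K j \<inter> snd -` E)" if "E \<in> sets borel" for j E
  proof -
    have "D j \<inter> g -` E = D j \<inter> g' j -` E" using gD by auto
    then show ?thesis using g'_law[OF that] by simp
  qed
  have Kdisj: "disjoint_family K" by (auto simp: disjoint_family_on_def K_def)
  have KU: "(\<Union>j. K j) = - {0}" by (auto simp: K_def)
  have "levy_law g = \<nu>"
  proof (rule levy_law_eqI[OF g \<nu>])
    fix E :: "'a set" assume E[measurable]: "E \<in> sets borel" and E0: "0 \<notin> E"
    have gE: "g -` E \<in> sets borel" "snd -` E \<in> sets (borel :: ('a \<times> 'a) measure)"
      using measurable_sets[OF g E] measurable_sets[OF borel_measurable_fst_snd(2) E] by auto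
    have "g -` E = (\<Union>j. D j \<inter> g -` E)" using g0 E0 by force
    then have "emeasure lborel (g -` E) = emeasure lborel (\<Union>j. D j \<inter> g -` E)" by simp
    also have "\<dots> = (\<Sum>j. emeasure lborel (D j \<inter> g -` E))"
      by (intro suminf_emeasure[symmetric]) (use gE Ddisj in \<open>auto simp: disjoint_family_on_def\<close>)
    also have "\<dots> = (\<Sum>j. emeasure \<gamma> (K j \<inter> snd -` E))" by (simp add: g_law)
    also have "\<dots> = emeasure \<gamma> (\<Union>j. K j \<inter> snd -` E)"
      by (intro suminf_emeasure) (use gE Kdisj s\<gamma> in \<open>auto simp: disjoint_family_on_def\<close>)
    also have "(\<Union>j. K j \<inter> snd -` E) = UNIV \<times> E"
      using KU E0 by (auto simp: zero_prod_def)
    also have "emeasure \<gamma> (UNIV \<times> E) = emeasure \<nu> E"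
      by (intro marginals_off_zero[OF \<gamma> \<mu>L \<nu>] E E0)
    finally show "emeasure lborel (g -` E) = emeasure \<nu> E" .
  qed
  moreover have "emeasure lborel {t. g t = 0} = \<infinity>"
  proof -
    have "g t = 0" if "t \<in> W (2 * i + 1)" for t i
    proof (rule g0, safe)
      fix j assume "t \<in> D j"
      moreover have "f t = 0" using that W(3) by blast
      ultimately have "odd j" "t \<in> W (j - 1)" by (auto simp: D_def B_def split: if_splits)
      moreover then have "j - 1 \<noteq> 2 * i + 1" by presburger
      ultimately show False using that W(1) unfolding disjoint_family_on_def by blast
    qed
    then have "emeasure lborel (\<Union>i. W (2 * i + 1)) \<le> emeasure lborel {t. g t = 0}"
      by (intro emeasure_mono) auto
    moreover have "emeasure lborel (\<Union>i. W (2 * i + 1)) = (\<Sum>i. emeasure lborel (W (2 * i + 1)))"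
      using W(1,2) by (intro suminf_emeasure[symmetric]) (auto simp: disjoint_family_on_def)
    moreover have "\<dots> = (\<Sum>i::nat. 1)" by (simp add: W(4) w_def)
    moreover have "\<dots> = (\<infinity>::ennreal)" by (simp flip: nn_integral_count_space_nat)
    ultimately show ?thesis by (simp add: top_unique)
  qed
  moreover have "(\<integral>\<^sup>+ t. ennreal ((norm (f t - g t))\<^sup>2) \<partial>lborel) \<le> ennreal c"
  proof -
    define e where "e j = (if even j then d (j div 2) else 0)" for j
    have eD: "norm (f t - e j) \<le> \<epsilon> * norm (f t)" if "t \<in> D j" for t j
      using that dq[of "f t"] W(3)[of "j - 1"] by (auto simp: D_def e_def B_def split: if_splits)
    have eK: "norm (fst z - e j) \<le> \<epsilon> * norm (fst z)" if "z \<in> K j" for z j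
      using that dq[of "fst z"] by (auto simp: K_def e_def code_def split: if_splits)
    \<comment> \<open>The squared distance of \<open>g\<close>, respectively of the second coordinate, to the centre of the
      current cell: the two functions have the same integral.\<close>
    let ?h = "\<lambda>t. \<Sum>j. ennreal ((norm (e j - g t))\<^sup>2) * indicator (D j) t"
    let ?k = "\<lambda>z. \<Sum>j. ennreal ((norm (e j - snd z))\<^sup>2) * indicator (K j) z"
    have sq: "(\<epsilon> * x)\<^sup>2 = \<epsilon>\<^sup>2 * x\<^sup>2" for x by (simp add: power_mult_distrib)
    have k_le: "?k z \<le> ennreal (1 + s) * ennreal ((norm (fst z - snd z))\<^sup>2)
        + ennreal ((1 + 1 / s) * \<epsilon>\<^sup>2) * ennreal ((norm (fst z))\<^sup>2)" for z
    proof (cases "z = 0")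
      case True
      then have "?k z = 0" by (simp add: K_def)
      then show ?thesis by simp
    next
      case False
      then obtain j where j: "z \<in> K j" by (auto simp: K_def)
      have "(norm (e j - snd z))\<^sup>2 = (norm ((fst z - snd z) + (e j - fst z)))\<^sup>2" by simp
      also have "\<dots> \<le> (1 + s) * (norm (fst z - snd z))\<^sup>2 + (1 + 1 / s) * (norm (e j - fst z))\<^sup>2"
        by (rule norm_add_sq_le_weighted[OF s])
      also have "\<dots> \<le> (1 + s) * (norm (fst z - snd z))\<^sup>2 + (1 + 1 / s) * (\<epsilon> * norm (fst z))\<^sup>2"
        using s eK[OF j] by (intro add_left_mono mult_left_mono power_mono) (auto simp: norm_minus_commute)
      finally show ?thesis
        unfolding suminf_cmult_indicator[OF Kdisj j] sq using s \<epsilon>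
        by (simp add: ennreal_mult[symmetric] ennreal_plus[symmetric] ennreal_leI mult.assoc del: ennreal_plus)
    qed
    have f_le: "ennreal ((norm (f t - g t))\<^sup>2) \<le> ennreal (1 + s) * ?h t
        + ennreal ((1 + 1 / s) * \<epsilon>\<^sup>2) * ennreal ((norm (f t))\<^sup>2)" for t
    proof (cases "t \<in> (\<Union>j. D j)")
      case False
      have "t \<in> D (2 * q (f t))" if "f t \<noteq> 0" using that by (simp add: D_def B_def)
      then have "f t = 0" using False by blast
      then show ?thesis using g0[OF False] by simp
    next
      case True
      then obtain j where j: "t \<in> D j" by auto
      have "(norm (f t - g t))\<^sup>2 = (norm ((e j - g t) + (f t - e j)))\<^sup>2" by simp
      also have "\<dots> \<le> (1 + s) * (norm (e j - g t))\<^sup>2 + (1 + 1 / s) * (norm (f t - e j))\<^sup>2"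
        by (rule norm_add_sq_le_weighted[OF s])
      also have "\<dots> \<le> (1 + s) * (norm (e j - g t))\<^sup>2 + (1 + 1 / s) * (\<epsilon> * norm (f t))\<^sup>2"
        using s eD[OF j] by (intro add_left_mono mult_left_mono power_mono) auto
      finally show ?thesis
        unfolding suminf_cmult_indicator[OF Ddisj j] sq using s \<epsilon>
        by (simp add: ennreal_mult[symmetric] ennreal_plus[symmetric] ennreal_leI mult.assoc del: ennreal_plus)
    qed
    have "(\<integral>\<^sup>+ t. ?h t \<partial>lborel) = (\<Sum>j. \<integral>\<^sup>+ t. ennreal ((norm (e j - g t))\<^sup>2) * indicator (D j) t \<partial>lborel)"
      by (intro nn_integral_suminf) measurable
    also have "\<dots> = (\<Sum>j. \<integral>\<^sup>+ z. ennreal ((norm (e j - snd z))\<^sup>2) * indicator (K j) z \<partial>\<gamma>)"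
    proof (intro suminf_cong)
      fix j
      show "(\<integral>\<^sup>+ t. ennreal ((norm (e j - g t))\<^sup>2) * indicator (D j) t \<partial>lborel)
          = (\<integral>\<^sup>+ z. ennreal ((norm (e j - snd z))\<^sup>2) * indicator (K j) z \<partial>\<gamma>)"
        by (rule nn_integral_on_piece[where h="\<lambda>y. ennreal ((norm (e j - y))\<^sup>2)", OF D g s\<gamma> K g_law]) auto
    qed
    also have "\<dots> = (\<integral>\<^sup>+ z. ?k z \<partial>\<gamma>)"
      by (intro nn_integral_suminf[symmetric]) measurable
    also have "\<dots> \<le> (\<integral>\<^sup>+ z. ennreal (1 + s) * ennreal ((norm (fst z - snd z))\<^sup>2)
        + ennreal ((1 + 1 / s) * \<epsilon>\<^sup>2) * ennreal ((norm (fst z))\<^sup>2) \<partial>\<gamma>)"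
      by (intro nn_integral_mono k_le)
    also have "\<dots> = ennreal (1 + s) * ennreal C + ennreal ((1 + 1 / s) * \<epsilon>\<^sup>2) * ennreal M"
      by (subst nn_integral_add, measurable, subst (1 2) nn_integral_cmult, measurable) (simp add: C M\<gamma>)
    also have "\<dots> = ennreal ((1 + s) * C + (1 + 1 / s) * (\<epsilon>\<^sup>2 * M))"
      using s C0 by (simp add: ennreal_mult[symmetric] ennreal_plus[symmetric] mult.assoc del: ennreal_plus)
    finally have h_le: "(\<integral>\<^sup>+ t. ?h t \<partial>lborel) \<le> ennreal ((1 + s) * C + (1 + 1 / s) * (\<epsilon>\<^sup>2 * M))" .
    have "(\<integral>\<^sup>+ t. ennreal ((norm (f t - g t))\<^sup>2) \<partial>lborel)
      \<le> (\<integral>\<^sup>+ t. ennreal (1 + s) * ?h t + ennreal ((1 + 1 / s) * \<epsilon>\<^sup>2) * ennreal ((norm (f t))\<^sup>2) \<partial>lborel)"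
      by (intro nn_integral_mono f_le)
    also have "\<dots> = ennreal (1 + s) * (\<integral>\<^sup>+ t. ?h t \<partial>lborel) + ennreal ((1 + 1 / s) * \<epsilon>\<^sup>2) * ennreal M"
      by (subst nn_integral_add, measurable, subst (1 2) nn_integral_cmult, measurable) (simp add: Mf)
    also have "\<dots> \<le> ennreal (1 + s) * ennreal ((1 + s) * C + (1 + 1 / s) * (\<epsilon>\<^sup>2 * M)) + ennreal ((1 + 1 / s) * \<epsilon>\<^sup>2) * ennreal M"
      by (intro add_right_mono mult_left_mono h_le) auto
    also have "\<dots> = ennreal ((1 + s) * ((1 + s) * C + (1 + 1 / s) * (\<epsilon>\<^sup>2 * M)) + (1 + 1 / s) * (\<epsilon>\<^sup>2 * M))"
      using s C0 by (simp add: ennreal_mult[symmetric] ennreal_plus[symmetric] mult.assoc del: ennreal_plus)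
    also have "\<dots> \<le> ennreal c" by (intro ennreal_leI bound)
    finally show ?thesis .
  qed
  ultimately show ?thesis using g by (intro that)
qed

section \<open>The metric axioms\<close>

text \<open>
  Representations on the line; the infinite zero set is the room that further lifting consumes.
\<close>

definition levy_rep :: "'a::euclidean_space measure \<Rightarrow> (real \<Rightarrow> 'a) set" where
  "levy_rep \<mu> = {f. f \<in> borel_measurable borel \<and> levy_law f = \<mu> \<and> emeasure lborel {t. f t = 0} = \<infinity>}"

definition L2_dist_sq :: "(real \<Rightarrow> 'a::euclidean_space) \<Rightarrow> (real \<Rightarrow> 'a) \<Rightarrow> ennreal" where
  "L2_dist_sq f g = (\<integral>\<^sup>+ t. ennreal ((norm (f t - g t))\<^sup>2) \<partial>lborel)"

lemma levy_rep_measurable: "f \<in> levy_rep \<mu> \<Longrightarrow> f \<in> borel_measurable borel"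
  by (simp add: levy_rep_def)

lemma levy_rep_law: "f \<in> levy_rep \<mu> \<Longrightarrow> levy_law f = \<mu>"
  by (simp add: levy_rep_def)

lemma Lambda2_levy: "\<mu> \<in> \<Lambda>\<^sub>2 \<Longrightarrow> levy_measure \<mu>"
  by (simp add: levy_measures2_def)

lemma levy_law_in_Lambda2:
  assumes f[measurable]: "f \<in> borel_measurable borel" and fin: "(\<integral>\<^sup>+ t. ennreal ((norm (f t))\<^sup>2) \<partial>lborel) < \<infinity>"
  shows "levy_law f \<in> \<Lambda>\<^sub>2"
proof -
  have 2: "(\<integral>\<^sup>+ x. ennreal ((norm x)\<^sup>2) \<partial>levy_law f) < \<infinity>"
    using fin by (subst nn_integral_levy_law) auto
  moreover have "(\<integral>\<^sup>+ x. ennreal (min 1 ((norm x)\<^sup>2)) \<partial>levy_law f) \<le> (\<integral>\<^sup>+ x. ennreal ((norm x)\<^sup>2) \<partial>levy_law f)"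
    by (intro nn_integral_mono ennreal_leI) auto
  ultimately show ?thesis
    using levy_law_zero[OF f] by (auto simp: levy_measures2_def levy_measure_def)
qed

lemma L2_norm_rep_finite:
  assumes "\<mu> \<in> \<Lambda>\<^sub>2" "f \<in> levy_rep \<mu>"
  shows "(\<integral>\<^sup>+ t. ennreal ((norm (f t))\<^sup>2) \<partial>lborel) < \<infinity>"
proof -
  have "(\<integral>\<^sup>+ x. ennreal ((norm x)\<^sup>2) \<partial>\<mu>) = (\<integral>\<^sup>+ t. ennreal ((norm (f t))\<^sup>2) \<partial>lborel)"
    using assms(2) nn_integral_levy_law[of f "\<lambda>x. ennreal ((norm x)\<^sup>2)"] by (auto simp: levy_rep_def)
  then show ?thesis using assms(1) by (simp add: levy_measures2_def)
qed

text \<open>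
  The zero function represents the zero measure, and the only way to couple the zero measure with
  \<open>\<mu>\<close> is to create all of \<open>\<mu>\<close> at the origin. Lifting this coupling represents
  \<open>\<mu>\<close>.
\<close>

lemma levy_rep_exists:
  fixes \<mu> :: "'a::euclidean_space measure"
  assumes \<mu>: "\<mu> \<in> \<Lambda>\<^sub>2"
  shows "levy_rep \<mu> \<noteq> {}"
proof -
  have \<mu>L: "levy_measure \<mu>" and \<mu>2: "(\<integral>\<^sup>+ x. ennreal ((norm x)\<^sup>2) \<partial>\<mu>) < \<infinity>" and s[measurable_cong]: "sets \<mu> = sets borel"
    and z: "emeasure \<mu> {0} = 0"
    using \<mu> by (auto simp: levy_measures2_def levy_measure_def)
  have sp: "space \<mu> = UNIV" using sets_eq_imp_space_eq[OF s] by simp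
  let ?o = "\<lambda>t::real. 0::'a"
  have o: "levy_law ?o \<in> \<Lambda>\<^sub>2" by (rule levy_law_in_Lambda2) auto
  let ?p = "\<lambda>y::'a. (0::'a, y)"
  have p[measurable]: "?p \<in> measurable \<mu> borel" using s by (simp cong: measurable_cong_sets)
  define \<gamma> where "\<gamma> = distr \<mu> borel ?p"
  have e\<gamma>: "emeasure \<gamma> E = emeasure \<mu> (?p -` E)" if "E \<in> sets borel" for E
    unfolding \<gamma>_def using that by (simp add: emeasure_distr sp)
  have "?p -` {0} = {0}" by (auto simp: zero_prod_def)
  then have "levy_measure \<gamma>"
    using \<mu>L by (auto simp: levy_measure_def e\<gamma> nn_integral_distr norm_Pair \<gamma>_def[symmetric])
      (auto simp: \<gamma>_def nn_integral_distr norm_Pair)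
  moreover have "emeasure \<gamma> (E \<times> UNIV) = emeasure (levy_law ?o) E \<and> emeasure \<gamma> (UNIV \<times> E) = emeasure \<mu> E"
    if E: "E \<in> sets borel" "0 \<notin> E" for E
  proof -
    have eq: "?p -` (E \<times> UNIV) = {}" "?p -` (UNIV \<times> E) = E" "?o -` E = {}" using E by auto
    have m: "E \<times> UNIV \<in> sets borel" "UNIV \<times> E \<in> sets borel" using E by (auto intro!: borel_Times)
    have "emeasure (levy_law ?o) E = emeasure lborel (?o -` E)"
      using E by (intro emeasure_levy_law_vimage) auto
    then show ?thesis
      unfolding e\<gamma>[OF m(1)] e\<gamma>[OF m(2)] eq by simp
  qed
  ultimately have \<gamma>: "\<gamma> \<in> levy_couplings (levy_law ?o) \<mu>"
    unfolding levy_couplings_def by auto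
  have "(\<integral>\<^sup>+ z. ennreal ((norm (fst z - snd z))\<^sup>2) \<partial>\<gamma>) = (\<integral>\<^sup>+ x. ennreal ((norm x)\<^sup>2) \<partial>\<mu>)"
    unfolding \<gamma>_def by (subst nn_integral_distr) auto
  then obtain c where "(\<integral>\<^sup>+ z. ennreal ((norm (fst z - snd z))\<^sup>2) \<partial>\<gamma>) < ennreal c"
  proof -
    have "\<exists>c. v < ennreal c" if "v < \<infinity>" for v
      using that by (cases v) (auto simp: ennreal_less_iff intro!: exI[of _ "enn2real v + 1"])
    then show ?thesis using \<mu>2 that \<open>_ = (\<integral>\<^sup>+ x. ennreal ((norm x)\<^sup>2) \<partial>\<mu>)\<close> by metis
  qed
  from lift_coupling[OF _ refl _ o \<mu>L \<gamma> this] show ?thesis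
    unfolding levy_rep_def by auto
qed

lemma lift_cost:
  fixes \<mu> \<nu> :: "'a::euclidean_space measure"
  assumes \<mu>: "\<mu> \<in> \<Lambda>\<^sub>2" and \<nu>: "\<nu> \<in> \<Lambda>\<^sub>2" and f: "f \<in> levy_rep \<mu>"
    and c: "levy_cost2 \<mu> \<nu> < ennreal c"
  shows "\<exists>g\<in>levy_rep \<nu>. L2_dist_sq f g \<le> ennreal (2 * c)"
proof -
  obtain \<gamma> where \<gamma>: "\<gamma> \<in> levy_couplings \<mu> \<nu>"
    and lt: "(\<integral>\<^sup>+ (x, y). ennreal (1 / 2 * (norm (x - y))\<^sup>2) \<partial>\<gamma>) < ennreal c"
    using c unfolding levy_cost2_def by (auto simp: INF_less_iff)
  have s[measurable_cong]: "sets \<gamma> = sets borel"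
    using \<gamma> by (auto simp: levy_couplings_def levy_measure_def)
  have "0 < c" using c by (metis ennreal_eq_0_iff linorder_not_le not_less_zero)
  have "(\<integral>\<^sup>+ z. ennreal ((norm (fst z - snd z))\<^sup>2) \<partial>\<gamma>) = (\<integral>\<^sup>+ z. 2 * ennreal (1 / 2 * (norm (fst z - snd z))\<^sup>2) \<partial>\<gamma>)"
    by (intro nn_integral_cong) (simp flip: ennreal_mult' ennreal_numeral)
  also have "\<dots> = 2 * (\<integral>\<^sup>+ z. ennreal (1 / 2 * (norm (fst z - snd z))\<^sup>2) \<partial>\<gamma>)"
    by (subst nn_integral_cmult) auto
  also have "\<dots> < 2 * ennreal c"
    using lt by (intro ennreal_mult_strict_left_mono) (auto simp: case_prod_beta')
  also have "\<dots> = ennreal (2 * c)" using \<open>0 < c\<close> by (simp add: ennreal_mult)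
  finally have lt': "(\<integral>\<^sup>+ z. ennreal ((norm (fst z - snd z))\<^sup>2) \<partial>\<gamma>) < ennreal (2 * c)" .
  have f': "f \<in> borel_measurable borel" "levy_law f = \<mu>" "emeasure lborel {t. f t = 0} = \<infinity>"
    using f by (auto simp: levy_rep_def)
  from lift_coupling[OF f'(1,2,3) \<mu> Lambda2_levy[OF \<nu>] \<gamma> lt'] show ?thesis
    unfolding levy_rep_def L2_dist_sq_def by blast
qed

lemma levy_cost2_le_of_L2:
  fixes \<mu> \<nu> :: "'a::euclidean_space measure"
  assumes f[measurable]: "f \<in> borel_measurable borel" and g[measurable]: "g \<in> borel_measurable borel"
    and l: "levy_law f = \<mu>" "levy_law g = \<nu>"
    and \<mu>: "\<mu> \<in> \<Lambda>\<^sub>2" and \<nu>: "\<nu> \<in> \<Lambda>\<^sub>2" and le: "L2_dist_sq f g \<le> ennreal (2 * c)" and c: "0 \<le> c"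
  shows "levy_cost2 \<mu> \<nu> \<le> ennreal c"
proof -
  have "levy_cost2 \<mu> \<nu> \<le> (\<integral>\<^sup>+ t. ennreal (1 / 2 * (norm (f t - g t))\<^sup>2) \<partial>lborel)"
    using levy_cost2_le_L2[OF f g] Lambda2_levy \<mu> \<nu> l by auto
  also have "\<dots> = (\<integral>\<^sup>+ t. ennreal (1/2) * ennreal ((norm (f t - g t))\<^sup>2) \<partial>lborel)"
    by (intro nn_integral_cong ennreal_mult) auto
  also have "\<dots> = ennreal (1/2) * L2_dist_sq f g"
    unfolding L2_dist_sq_def by (subst nn_integral_cmult) auto
  also have "\<dots> \<le> ennreal (1/2) * ennreal (2 * c)" by (intro mult_left_mono le) auto
  also have "\<dots> = ennreal c" using c by (subst ennreal_mult'[symmetric]) auto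
  finally show ?thesis .
qed

lemma levy_cost2_finite:
  fixes \<mu> \<nu> :: "'a::euclidean_space measure"
  assumes \<mu>: "\<mu> \<in> \<Lambda>\<^sub>2" and \<nu>: "\<nu> \<in> \<Lambda>\<^sub>2"
  shows "levy_cost2 \<mu> \<nu> < \<infinity>"
proof -
  obtain f g where fg: "f \<in> levy_rep \<mu>" "g \<in> levy_rep \<nu>"
    using levy_rep_exists[OF \<mu>] levy_rep_exists[OF \<nu>] by blast
  note [measurable] = fg[THEN levy_rep_measurable]
  have "levy_cost2 \<mu> \<nu> \<le> (\<integral>\<^sup>+ t. ennreal (1 / 2 * (norm (f t - g t))\<^sup>2) \<partial>lborel)"
    using levy_cost2_le_L2[OF fg[THEN levy_rep_measurable]] fg[THEN levy_rep_law] Lambda2_levy \<mu> \<nu> by auto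
  also have "\<dots> \<le> (\<integral>\<^sup>+ t. ennreal ((norm (f t))\<^sup>2) + ennreal ((norm (g t))\<^sup>2) \<partial>lborel)"
  proof (intro nn_integral_mono)
    fix t
    show "ennreal (1 / 2 * (norm (f t - g t))\<^sup>2) \<le> ennreal ((norm (f t))\<^sup>2) + ennreal ((norm (g t))\<^sup>2)"
      using norm_add_sq_le_weighted[of 1 "f t" "- g t"]
      by (simp add: ennreal_plus[symmetric] ennreal_leI del: ennreal_plus)
  qed
  also have "\<dots> = (\<integral>\<^sup>+ t. ennreal ((norm (f t))\<^sup>2) \<partial>lborel) + (\<integral>\<^sup>+ t. ennreal ((norm (g t))\<^sup>2) \<partial>lborel)"
    by (subst nn_integral_add) auto
  also have "\<dots> < \<infinity>" using L2_norm_rep_finite[OF \<mu> fg(1)] L2_norm_rep_finite[OF \<nu> fg(2)] by simp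
  finally show ?thesis .
qed

lemma lift_wasserstein:
  fixes \<mu> \<nu> :: "'a::euclidean_space measure"
  assumes \<mu>: "\<mu> \<in> \<Lambda>\<^sub>2" and \<nu>: "\<nu> \<in> \<Lambda>\<^sub>2" and f: "f \<in> levy_rep \<mu>"
    and a: "levy_wasserstein \<mu> \<nu> < a"
  shows "\<exists>g\<in>levy_rep \<nu>. L2_dist_sq f g \<le> ennreal (2 * a\<^sup>2)"
proof (rule lift_cost[OF \<mu> \<nu> f])
  obtain r where r: "levy_cost2 \<mu> \<nu> = ennreal r" "0 \<le> r"
    using levy_cost2_finite[OF \<mu> \<nu>] by (cases "levy_cost2 \<mu> \<nu>") auto
  have "sqrt r < a" using a r by (simp add: levy_wasserstein_def)
  then have "(sqrt r)\<^sup>2 < a\<^sup>2" using r(2) by (intro power_strict_mono) auto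
  then show "levy_cost2 \<mu> \<nu> < ennreal (a\<^sup>2)"
    using r by (simp add: ennreal_less_iff)
qed

lemma wasserstein_le_of_L2:
  fixes \<mu> \<nu> :: "'a::euclidean_space measure"
  assumes "f \<in> borel_measurable borel" "g \<in> borel_measurable borel" "levy_law f = \<mu>" "levy_law g = \<nu>"
    and "\<mu> \<in> \<Lambda>\<^sub>2" "\<nu> \<in> \<Lambda>\<^sub>2" "L2_dist_sq f g \<le> ennreal (2 * a\<^sup>2)" and a: "0 \<le> a"
  shows "levy_wasserstein \<mu> \<nu> \<le> a"
proof -
  have "levy_cost2 \<mu> \<nu> \<le> ennreal (a\<^sup>2)" using assms by (intro levy_cost2_le_of_L2[of f g]) auto
  then have "enn2real (levy_cost2 \<mu> \<nu>) \<le> a\<^sup>2" by (intro enn2real_leI) auto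
  then show ?thesis unfolding levy_wasserstein_def using a by (metis real_sqrt_le_iff real_sqrt_unique)
qed

text \<open>
  The weights \<open>1 + b / a\<close> and \<open>1 + a / b\<close> are the optimal ones: they turn
  \<open>a\<^sup>2\<close> and \<open>b\<^sup>2\<close> into \<open>(a + b)\<^sup>2\<close>.
\<close>

lemma L2_dist_sq_triangle:
  fixes f g h :: "real \<Rightarrow> 'a::euclidean_space"
  assumes [measurable]: "f \<in> borel_measurable borel" "g \<in> borel_measurable borel" "h \<in> borel_measurable borel"
    and fg: "L2_dist_sq f g \<le> ennreal (2 * a\<^sup>2)" and gh: "L2_dist_sq g h \<le> ennreal (2 * b\<^sup>2)"
    and ab: "0 < a" "0 < b"
  shows "L2_dist_sq f h \<le> ennreal (2 * (a + b)\<^sup>2)"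
proof -
  have "L2_dist_sq f h \<le> (\<integral>\<^sup>+ t. ennreal (1 + b / a) * ennreal ((norm (f t - g t))\<^sup>2)
      + ennreal (1 + a / b) * ennreal ((norm (g t - h t))\<^sup>2) \<partial>lborel)"
    unfolding L2_dist_sq_def
  proof (intro nn_integral_mono)
    fix t
    show "ennreal ((norm (f t - h t))\<^sup>2) \<le> ennreal (1 + b / a) * ennreal ((norm (f t - g t))\<^sup>2)
      + ennreal (1 + a / b) * ennreal ((norm (g t - h t))\<^sup>2)"
      using norm_add_sq_le_weighted[of "b / a" "f t - g t" "g t - h t"] ab
      by (simp add: ennreal_mult[symmetric] ennreal_plus[symmetric] ennreal_leI del: ennreal_plus)
  qed
  also have "\<dots> = ennreal (1 + b / a) * L2_dist_sq f g + ennreal (1 + a / b) * L2_dist_sq g h"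
    unfolding L2_dist_sq_def
    by (subst nn_integral_add, measurable, subst (1 2) nn_integral_cmult, measurable)
  also have "\<dots> \<le> ennreal (1 + b / a) * ennreal (2 * a\<^sup>2) + ennreal (1 + a / b) * ennreal (2 * b\<^sup>2)"
    by (intro add_mono mult_left_mono fg gh) auto
  also have "\<dots> = ennreal ((1 + b / a) * (2 * a\<^sup>2) + (1 + a / b) * (2 * b\<^sup>2))"
    using ab by (simp add: ennreal_mult[symmetric] ennreal_plus[symmetric] del: ennreal_plus)
  also have "(1 + b / a) * (2 * a\<^sup>2) + (1 + a / b) * (2 * b\<^sup>2) = 2 * (a + b)\<^sup>2"
    using ab by (simp add: power2_eq_square field_simps)
  finally show ?thesis .
qed

lemma wasserstein_nonneg: "0 \<le> levy_wasserstein \<mu> \<nu>"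
  by (simp add: levy_wasserstein_def)

text \<open>
  Two successive lifts play the role of gluing couplings: afterwards all three measures are represented on one
  line, and the triangle inequality is that of \<open>L\<^sup>2\<close>.
\<close>

lemma wasserstein_triangle:
  fixes \<mu> \<nu> \<rho> :: "'a::euclidean_space measure"
  assumes \<mu>: "\<mu> \<in> \<Lambda>\<^sub>2" and \<nu>: "\<nu> \<in> \<Lambda>\<^sub>2" and \<rho>: "\<rho> \<in> \<Lambda>\<^sub>2"
  shows "levy_wasserstein \<mu> \<rho> \<le> levy_wasserstein \<mu> \<nu> + levy_wasserstein \<nu> \<rho>"
proof (rule field_le_epsilon)
  fix e :: real assume e: "0 < e"
  let ?a = "levy_wasserstein \<mu> \<nu> + e / 2" and ?b = "levy_wasserstein \<nu> \<rho> + e / 2"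
  obtain f where f: "f \<in> levy_rep \<mu>" using levy_rep_exists[OF \<mu>] by blast
  obtain g where g: "g \<in> levy_rep \<nu>" "L2_dist_sq f g \<le> ennreal (2 * ?a\<^sup>2)"
    using lift_wasserstein[OF \<mu> \<nu> f, of ?a] e by auto
  obtain h where h: "h \<in> levy_rep \<rho>" "L2_dist_sq g h \<le> ennreal (2 * ?b\<^sup>2)"
    using lift_wasserstein[OF \<nu> \<rho> g(1), of ?b] e by auto
  have "L2_dist_sq f h \<le> ennreal (2 * (?a + ?b)\<^sup>2)"
    using f g h e by (intro L2_dist_sq_triangle[of f g h]) (auto simp: levy_rep_measurable intro: add_nonneg_pos wasserstein_nonneg)
  then have "levy_wasserstein \<mu> \<rho> \<le> ?a + ?b"
    using f h \<mu> \<rho> e wasserstein_nonneg[of \<mu> \<nu>] wasserstein_nonneg[of \<nu> \<rho>]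
    by (intro wasserstein_le_of_L2[of f h]) (auto simp: levy_rep_def)
  then show "levy_wasserstein \<mu> \<rho> \<le> levy_wasserstein \<mu> \<nu> + levy_wasserstein \<nu> \<rho> + e" by simp
qed

text \<open>
  The metric axioms ask for symmetry at all pairs of measures, also where no representation by functions is
  available; exchanging the coordinates of a coupling works in general.
\<close>

lemma swap_coupling:
  fixes \<mu> \<nu> :: "'a::euclidean_space measure"
  assumes \<gamma>: "\<gamma> \<in> levy_couplings \<mu> \<nu>"
  shows "distr \<gamma> borel prod.swap \<in> levy_couplings \<nu> \<mu>"
proof -
  have s[measurable_cong]: "sets \<gamma> = sets borel" and L: "levy_measure \<gamma>"
    using \<gamma> by (auto simp: levy_couplings_def levy_measure_def)
  have sp: "space \<gamma> = UNIV" using sets_eq_imp_space_eq[OF s] by simp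
  have sw: "(prod.swap :: 'a \<times> 'a \<Rightarrow> _) \<in> borel_measurable borel"
    by (intro borel_measurable_continuous_onI continuous_on_swap)
  then have [measurable]: "prod.swap \<in> measurable \<gamma> borel" using s by (simp cong: measurable_cong_sets)
  have e: "emeasure (distr \<gamma> borel prod.swap) E = emeasure \<gamma> (prod.swap -` E)" if "E \<in> sets borel" for E
    using that by (simp add: emeasure_distr sp)
  have "levy_measure (distr \<gamma> borel prod.swap)"
  proof -
    have "prod.swap -` {0} = {0 :: 'a \<times> 'a}" by (auto simp: zero_prod_def)
    moreover have "norm (prod.swap z) = norm z" for z :: "'a \<times> 'a"
      by (cases z) (simp add: norm_Pair add.commute)
    ultimately show ?thesis
      using L by (simp add: levy_measure_def e nn_integral_distr)
  qed
  moreover have "emeasure (distr \<gamma> borel prod.swap) (E \<times> UNIV) = emeasure \<gamma> (UNIV \<times> E)"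
    "emeasure (distr \<gamma> borel prod.swap) (UNIV \<times> E) = emeasure \<gamma> (E \<times> UNIV)" if "E \<in> sets borel" for E
  proof -
    have "prod.swap -` (E \<times> UNIV) = UNIV \<times> E" "prod.swap -` (UNIV \<times> E) = E \<times> UNIV" by auto
    then show "emeasure (distr \<gamma> borel prod.swap) (E \<times> UNIV) = emeasure \<gamma> (UNIV \<times> E)"
      "emeasure (distr \<gamma> borel prod.swap) (UNIV \<times> E) = emeasure \<gamma> (E \<times> UNIV)"
      using e[of "E \<times> UNIV"] e[of "UNIV \<times> E"] that by (metis borel_Times sets.top space_borel)+
  qed
  ultimately show ?thesis
    using \<gamma> unfolding levy_couplings_def by auto
qed

lemma levy_cost2_commute_le: "levy_cost2 \<nu> \<mu> \<le> levy_cost2 \<mu> (\<nu> :: 'a::euclidean_space measure)"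
  unfolding levy_cost2_def
proof (rule INF_mono)
  fix \<gamma> assume \<gamma>: "\<gamma> \<in> levy_couplings \<mu> \<nu>"
  have s[measurable_cong]: "sets \<gamma> = sets borel"
    using \<gamma> by (auto simp: levy_couplings_def levy_measure_def)
  have "(prod.swap :: 'a \<times> 'a \<Rightarrow> _) \<in> borel_measurable borel"
    by (intro borel_measurable_continuous_onI continuous_on_swap)
  then have [measurable]: "prod.swap \<in> measurable \<gamma> borel" using s by (simp cong: measurable_cong_sets)
  have "(\<integral>\<^sup>+ (x, y). ennreal (1 / 2 * (norm (x - y))\<^sup>2) \<partial>distr \<gamma> borel prod.swap)
      = (\<integral>\<^sup>+ (x, y). ennreal (1 / 2 * (norm (x - y))\<^sup>2) \<partial>\<gamma>)"
    unfolding case_prod_beta'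
    by (subst nn_integral_distr) (auto simp: norm_minus_commute)
  then show "\<exists>\<gamma>'\<in>levy_couplings \<nu> \<mu>. (\<integral>\<^sup>+ (x, y). ennreal (1 / 2 * (norm (x - y))\<^sup>2) \<partial>\<gamma>')
      \<le> (\<integral>\<^sup>+ (x, y). ennreal (1 / 2 * (norm (x - y))\<^sup>2) \<partial>\<gamma>)"
    using swap_coupling[OF \<gamma>] by (intro bexI[of _ "distr \<gamma> borel prod.swap"]) auto
qed

lemma wasserstein_commute: "levy_wasserstein \<mu> \<nu> = levy_wasserstein \<nu> (\<mu> :: 'a::euclidean_space measure)"
  unfolding levy_wasserstein_def by (metis levy_cost2_commute_le antisym)

lemma wasserstein_self:
  fixes \<mu> :: "'a::euclidean_space measure"
  assumes \<mu>: "\<mu> \<in> \<Lambda>\<^sub>2"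
  shows "levy_wasserstein \<mu> \<mu> = 0"
proof -
  obtain f where f: "f \<in> levy_rep \<mu>" using levy_rep_exists[OF \<mu>] by blast
  have "levy_wasserstein \<mu> \<mu> \<le> 0"
    using f \<mu> by (intro wasserstein_le_of_L2[of f f]) (auto simp: levy_rep_def L2_dist_sq_def)
  then show ?thesis using wasserstein_nonneg[of \<mu> \<mu>] by simp
qed

text \<open>
  Chebyshev's inequality: where \<open>f\<close> is in \<open>C\<close>, either \<open>g\<close> is in the
  closed \<open>\<delta>\<close>-neighbourhood of \<open>C\<close> or the two functions differ by at least
  \<open>\<delta>\<close>, and the latter happens on a set of arbitrarily small measure. The neighbourhoods
  shrink to \<open>C\<close>; as they stay away from the origin their masses are finite and converge.
\<close>

lemma closed_le_of_wasserstein_zero: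
  fixes \<mu> \<nu> :: "'a::euclidean_space measure"
  assumes \<mu>: "\<mu> \<in> \<Lambda>\<^sub>2" and \<nu>: "\<nu> \<in> \<Lambda>\<^sub>2" and W: "levy_wasserstein \<mu> \<nu> = 0"
    and C: "closed C" "0 \<notin> C"
  shows "emeasure \<mu> C \<le> emeasure \<nu> C"
proof (cases "C = {}")
  case False
  have s: "sets \<nu> = sets borel" using \<nu> by (simp add: levy_measures2_def levy_measure_def)
  define r where "r = infdist 0 C"
  have r: "0 < r" unfolding r_def using C False infdist_pos_not_in_closed by blast
  define F where "F n = {x. infdist x C \<le> r / real (n + 2)}" for n
  have Fc: "closed (F n)" for n
    unfolding F_def by (intro closed_Collect_le continuous_intros)
  have F: "F n \<in> sets borel" for n using Fc by (rule borel_closed)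
  have Faway: "F n \<inter> ball 0 (r / 2) = {}" for n
  proof -
    have "r / real (n + 2) \<le> r / 2" using r by (intro divide_left_mono) auto
    moreover have "r \<le> infdist x C + norm x" for x
      unfolding r_def using infdist_triangle[of 0 C x] by simp
    ultimately have "r / 2 \<le> norm x" if "x \<in> F n" for x
      using that field_sum_of_halves[of r] unfolding F_def by (smt (verit) mem_Collect_eq)
    then show ?thesis by (force simp: not_less[symmetric])
  qed
  have F0: "0 \<notin> F n" for n using Faway[of n] r by (auto simp: disjoint_iff)
  have "emeasure \<mu> C \<le> emeasure \<nu> (F n)" for n
  proof (rule ennreal_le_epsilon)
    fix e :: real assume e: "0 < e"
    define \<delta> where "\<delta> = r / real (n + 2)"
    have \<delta>: "0 < \<delta>" using r by (simp add: \<delta>_def)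
    \<comment> \<open>Chosen so that the bound \<open>2 * a\<^sup>2\<close> on the squared distance turns into mass at most \<open>e\<close>.\<close>
    define a where "a = sqrt (e * \<delta>\<^sup>2 / 2)"
    have a: "0 < a" "2 * a\<^sup>2 = \<delta>\<^sup>2 * e" using e \<delta> by (simp_all add: a_def)
    have Wa: "levy_wasserstein \<mu> \<nu> < a" using a(1) W by simp
    obtain f where f: "f \<in> levy_rep \<mu>" using levy_rep_exists[OF \<mu>] by blast
    obtain g where g: "g \<in> levy_rep \<nu>" "L2_dist_sq f g \<le> ennreal (2 * a\<^sup>2)"
      using lift_wasserstein[OF \<mu> \<nu> f Wa] by blast
    note fm[measurable] = levy_rep_measurable[OF f]
    note gm[measurable] = levy_rep_measurable[OF g(1)]
    define S where "S = {t. \<delta> \<le> norm (f t - g t)}"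
    have S[measurable]: "S \<in> sets borel" unfolding S_def by measurable
    have "ennreal (\<delta>\<^sup>2) * emeasure lborel S = (\<integral>\<^sup>+ t. ennreal (\<delta>\<^sup>2) * indicator S t \<partial>lborel)"
      by (subst nn_integral_cmult_indicator) auto
    also have "\<dots> \<le> L2_dist_sq f g"
      unfolding L2_dist_sq_def using \<delta>
      by (intro nn_integral_mono) (auto simp: S_def indicator_def intro!: ennreal_leI power_mono)
    also have "\<dots> \<le> ennreal (\<delta>\<^sup>2) * ennreal e"
      using g(2) a(2) e by (simp add: ennreal_mult)
    finally have "emeasure lborel S \<le> ennreal e"
      using \<delta> by (simp add: ennreal_mult_le_mult_iff)
    have "emeasure \<mu> C = emeasure lborel (f -` C)"
      using emeasure_levy_law_vimage[OF fm _ C(2)] C(1) levy_rep_law[OF f] by auto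
    also have "\<dots> \<le> emeasure lborel (g -` F n \<union> S)"
    proof (intro emeasure_mono)
      have "g -` F n \<in> sets borel" using measurable_sets[OF gm F[of n]] by simp
      then show "g -` F n \<union> S \<in> sets lborel" by auto
      show "f -` C \<subseteq> g -` F n \<union> S"
      proof
        fix t assume "t \<in> f -` C"
        then have "infdist (g t) C \<le> dist (g t) (f t)" by (intro infdist_le) auto
        then show "t \<in> g -` F n \<union> S"
          by (auto simp: F_def S_def \<delta>_def dist_norm norm_minus_commute)
      qed
    qed
    also have "\<dots> \<le> emeasure lborel (g -` F n) + emeasure lborel S"
      using measurable_sets[OF gm F[of n]] by (intro emeasure_subadditive) auto
    also have "emeasure lborel (g -` F n) = emeasure \<nu> (F n)"
      using emeasure_levy_law_vimage[OF gm F F0] levy_rep_law[OF g(1)] by auto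
    finally show "emeasure \<mu> C \<le> emeasure \<nu> (F n) + ennreal e"
      using \<open>emeasure lborel S \<le> ennreal e\<close> by (meson add_left_mono order_trans)
  qed
  then have "emeasure \<mu> C \<le> (INF n. emeasure \<nu> (F n))" by (intro INF_greatest)
  also have "\<dots> = emeasure \<nu> (\<Inter>n. F n)"
  proof (intro INF_emeasure_decseq)
    show "range F \<subseteq> sets \<nu>" using F s by auto
    show "decseq F" unfolding decseq_def F_def using r
      by (auto elim!: order_trans intro!: divide_left_mono)
    show "emeasure \<nu> (F i) \<noteq> \<infinity>" for i
      using levy_measure_finite_away[OF Lambda2_levy[OF \<nu>] F open_ball _ Faway] r by (auto simp: less_top)
  qed
  also have "(\<Inter>n. F n) = C"
  proof -
    have "(\<lambda>n. r / real (n + 2)) \<longlonglongrightarrow> 0"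
      using LIMSEQ_ignore_initial_segment[OF lim_const_over_n[of r], of 2] by simp
    then have le0: "infdist x C \<le> 0" if "\<And>n. x \<in> F n" for x
      by (rule LIMSEQ_le_const) (use that in \<open>auto simp: F_def\<close>)
    show ?thesis
    proof (intro equalityI subsetI)
      fix x assume "x \<in> (\<Inter>n. F n)"
      then have "infdist x C = 0" using le0[of x] infdist_nonneg[of x C] by (simp add: order_antisym)
      then show "x \<in> C" using in_closed_iff_infdist_zero[OF C(1) False] by blast
    next
      fix x assume "x \<in> C"
      then show "x \<in> (\<Inter>n. F n)" using r by (simp add: F_def)
    qed
  qed
  finally show ?thesis .
qed simp

text \<open>
  Two measures that agree on closed sets are equal, provided that countably many closed sets of finite mass
  cover the space. The complements of balls around the origin together with the null set \<open>{0}\<close> do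
  so.
\<close>

lemma eq_of_wasserstein_zero:
  fixes \<mu> \<nu> :: "'a::euclidean_space measure"
  assumes \<mu>: "\<mu> \<in> \<Lambda>\<^sub>2" and \<nu>: "\<nu> \<in> \<Lambda>\<^sub>2" and W: "levy_wasserstein \<mu> \<nu> = 0"
  shows "\<mu> = \<nu>"
proof -
  have s: "sets \<mu> = sets borel" "sets \<nu> = sets borel" and z: "emeasure \<mu> {0} = 0" "emeasure \<nu> {0} = 0"
    using \<mu> \<nu> by (auto simp: levy_measures2_def levy_measure_def)
  have W': "levy_wasserstein \<nu> \<mu> = 0"
    using W wasserstein_commute by metis
  have eq0: "emeasure \<mu> C = emeasure \<nu> C" if "closed C" "0 \<notin> C" for C
    using closed_le_of_wasserstein_zero[OF \<mu> \<nu> W that] closed_le_of_wasserstein_zero[OF \<nu> \<mu> W' that] by simp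
  let ?A = "\<lambda>n::nat. - ball (0::'a) (1 / real (Suc n))"
  have Ainc: "incseq ?A"
    unfolding incseq_Suc_iff by (intro allI Compl_anti_mono subset_ball) (simp add: frac_le)
  have AU: "(\<Union>n. ?A n) = - {0}"
  proof -
    have "\<exists>n. x \<in> ?A n" if "x \<noteq> 0" for x
    proof -
      have "0 < norm x" using that by simp
      from reals_Archimedean[OF this] show ?thesis by (auto simp: inverse_eq_divide not_less intro: less_imp_le)
    qed
    moreover have "0 \<notin> ?A n" for n by simp
    ultimately show ?thesis by blast
  qed
  have sup: "emeasure \<rho> C = (SUP n. emeasure \<rho> (C \<inter> ?A n))"
    if "closed C" "sets \<rho> = sets borel" "emeasure \<rho> {0} = 0" for C \<rho>
  proof -
    have "emeasure \<rho> C = emeasure \<rho> (C - {0})"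
      by (rule emeasure_Diff_null_set[symmetric]) (use that in auto)
    also have "C - {0} = (\<Union>n. C \<inter> ?A n)" using AU by blast
    also have "emeasure \<rho> \<dots> = (SUP n. emeasure \<rho> (C \<inter> ?A n))"
      by (intro SUP_emeasure_incseq[symmetric]) (use that Ainc in \<open>auto simp: incseq_def simp del: of_nat_Suc\<close>)
    finally show ?thesis .
  qed
  have eq: "emeasure \<mu> C = emeasure \<nu> C" if "closed C" for C
  proof -
    have "emeasure \<mu> (C \<inter> ?A n) = emeasure \<nu> (C \<inter> ?A n)" for n
      by (intro eq0 closed_Int that) auto
    then show ?thesis using sup[OF that s(1) z(1)] sup[OF that s(2) z(2)] by simp
  qed
  show ?thesis
  proof (rule measure_eqI_generator_eq[where E="Collect closed" and \<Omega>=UNIV and A="\<lambda>n. case n of 0 \<Rightarrow> {0} | Suc n \<Rightarrow> ?A n"])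
    show "Int_stable (Collect closed :: 'a set set)" by (auto simp: Int_stable_def)
    show "sets \<mu> = sigma_sets UNIV (Collect closed)" "sets \<nu> = sigma_sets UNIV (Collect closed)"
      using s by (simp_all add: borel_eq_closed)
    show "(\<Union>i. case i of 0 \<Rightarrow> {0} | Suc n \<Rightarrow> ?A n) = (UNIV :: 'a set)"
    proof -
      have "(\<Union>i. case i of 0 \<Rightarrow> {0} | Suc n \<Rightarrow> ?A n) = {0} \<union> (\<Union>n. ?A n)"
        by (subst UNIV_nat_eq) auto
      then show ?thesis unfolding AU by auto
    qed
    show "emeasure \<mu> (case i of 0 \<Rightarrow> {0} | Suc n \<Rightarrow> ?A n) \<noteq> \<infinity>" for i
      using levy_measure_finite_away[OF Lambda2_levy[OF \<mu>], of "?A (i - 1)" "ball 0 (1 / real (Suc (i - 1)))"] z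
      by (cases i) auto
    show "range (\<lambda>i. case i of 0 \<Rightarrow> {0} | Suc n \<Rightarrow> ?A n) \<subseteq> Collect closed"
      by (simp add: image_subset_iff closed_Compl split: nat.split)
    show "emeasure \<mu> X = emeasure \<nu> X" if "X \<in> Collect closed" for X
      using eq that by simp
  qed simp
qed

lemma wasserstein_metric: "Metric_space (\<Lambda>\<^sub>2 :: 'a::euclidean_space measure set) levy_wasserstein"
proof
  fix x y z :: "'a measure"
  show "0 \<le> levy_wasserstein x y" by (rule wasserstein_nonneg)
  show "levy_wasserstein x y = levy_wasserstein y x" by (rule wasserstein_commute)
  show "(levy_wasserstein x y = 0) = (x = y)" if "x \<in> \<Lambda>\<^sub>2" "y \<in> \<Lambda>\<^sub>2"
    using eq_of_wasserstein_zero wasserstein_self that by blast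
  show "levy_wasserstein x z \<le> levy_wasserstein x y + levy_wasserstein y z" if "x \<in> \<Lambda>\<^sub>2" "y \<in> \<Lambda>\<^sub>2" "z \<in> \<Lambda>\<^sub>2"
    by (rule wasserstein_triangle[OF that])
qed

section \<open>Completeness\<close>

lemma L2_norm_finite_of_dist:
  fixes f g :: "real \<Rightarrow> 'a::euclidean_space"
  assumes [measurable]: "f \<in> borel_measurable borel" "g \<in> borel_measurable borel"
    and f: "(\<integral>\<^sup>+ t. ennreal ((norm (f t))\<^sup>2) \<partial>lborel) < \<infinity>" and d: "L2_dist_sq f g < \<infinity>"
  shows "(\<integral>\<^sup>+ t. ennreal ((norm (g t))\<^sup>2) \<partial>lborel) < \<infinity>"
proof -
  have "(\<integral>\<^sup>+ t. ennreal ((norm (g t))\<^sup>2) \<partial>lborel)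
      \<le> (\<integral>\<^sup>+ t. 2 * ennreal ((norm (f t))\<^sup>2) + 2 * ennreal ((norm (f t - g t))\<^sup>2) \<partial>lborel)"
  proof (intro nn_integral_mono)
    fix t
    have "(norm (g t))\<^sup>2 \<le> 2 * (norm (f t))\<^sup>2 + 2 * (norm (f t - g t))\<^sup>2"
      using norm_add_sq_le_weighted[of 1 "f t" "- (f t - g t)"] by (simp add: norm_minus_commute)
    then have "ennreal ((norm (g t))\<^sup>2) \<le> ennreal (2 * (norm (f t))\<^sup>2 + 2 * (norm (f t - g t))\<^sup>2)"
      by (rule ennreal_leI)
    then show "ennreal ((norm (g t))\<^sup>2) \<le> 2 * ennreal ((norm (f t))\<^sup>2) + 2 * ennreal ((norm (f t - g t))\<^sup>2)"
      by (simp add: ennreal_mult)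
  qed
  also have "\<dots> = 2 * (\<integral>\<^sup>+ t. ennreal ((norm (f t))\<^sup>2) \<partial>lborel) + 2 * L2_dist_sq f g"
    unfolding L2_dist_sq_def by (subst nn_integral_add, measurable, subst (1 2) nn_integral_cmult, measurable)
  also have "\<dots> < \<infinity>" using f d by (auto simp: ennreal_mult_less_top)
  finally show ?thesis .
qed

lemma geometric_steps_bound:
  fixes x :: "nat \<Rightarrow> 'a::real_normed_vector"
  assumes "\<And>n. norm (x n - x (Suc n)) \<le> r * (1 / 2) ^ n"
  shows "norm (x n - x (n + k)) \<le> 2 * r * (1 / 2) ^ n - 2 * r * (1 / 2) ^ (n + k)"
proof (induction k)
  case (Suc k)
  have "norm (x n - x (n + Suc k)) \<le> norm (x n - x (n + k)) + norm (x (n + k) - x (Suc (n + k)))"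
    using norm_triangle_ineq[of "x n - x (n + k)" "x (n + k) - x (Suc (n + k))"] by simp
  also have "\<dots> \<le> 2 * r * (1 / 2) ^ n - 2 * r * (1 / 2) ^ (n + k) + r * (1 / 2) ^ (n + k)"
    by (intro add_mono Suc.IH assms)
  finally show ?case by simp
qed simp

text \<open>
  Weighting the squared steps by \<open>4 ^ n\<close> keeps their sum \<open>S\<close> integrable. Where
  \<open>S\<close> is finite, hence almost everywhere, the \<open>n\<close>-th step is at most \<open>2 ^ -
  n\<close> times the square root of \<open>S\<close>; so the functions converge pointwise, and the tail of the
  geometric series bounds the distance to the limit.
\<close>

lemma fast_L2_Cauchy_converges:
  fixes F :: "nat \<Rightarrow> real \<Rightarrow> 'a::euclidean_space"
  assumes F[measurable]: "\<And>n. F n \<in> borel_measurable borel"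
    and step: "\<And>n. L2_dist_sq (F n) (F (Suc n)) \<le> ennreal ((1 / 16) ^ n)"
  obtains f where "f \<in> borel_measurable borel" "\<And>n. L2_dist_sq (F n) f \<le> ennreal (8 * (1 / 4) ^ n)"
proof -
  define S where "S t = (\<Sum>n. ennreal (4 ^ n) * ennreal ((norm (F n t - F (Suc n) t))\<^sup>2))" for t
  have [measurable]: "S \<in> borel_measurable borel" unfolding S_def by measurable
  have "(\<integral>\<^sup>+ t. S t \<partial>lborel)
      = (\<Sum>n. \<integral>\<^sup>+ t. ennreal (4 ^ n) * ennreal ((norm (F n t - F (Suc n) t))\<^sup>2) \<partial>lborel)"
    unfolding S_def by (intro nn_integral_suminf) measurable
  also have "\<dots> = (\<Sum>n. ennreal (4 ^ n) * L2_dist_sq (F n) (F (Suc n)))"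
    unfolding L2_dist_sq_def by (intro suminf_cong nn_integral_cmult) measurable
  also have "\<dots> \<le> (\<Sum>n. ennreal ((1 / 4) ^ n))"
  proof (intro suminf_le)
    fix n
    have "ennreal (4 ^ n) * L2_dist_sq (F n) (F (Suc n)) \<le> ennreal (4 ^ n) * ennreal ((1 / 16) ^ n)"
      by (intro mult_left_mono step) auto
    also have "\<dots> = ennreal ((1 / 4) ^ n)"
      by (simp flip: ennreal_mult power_mult_distrib)
    finally show "ennreal (4 ^ n) * L2_dist_sq (F n) (F (Suc n)) \<le> ennreal ((1 / 4) ^ n)" .
  qed auto
  also have "\<dots> = ennreal (\<Sum>n. (1 / 4) ^ n)"
    by (intro suminf_ennreal2) (auto intro: summable_geometric)
  also have "\<dots> \<le> ennreal 2"
    by (intro ennreal_leI) (simp add: suminf_geometric)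
  finally have S2: "(\<integral>\<^sup>+ t. S t \<partial>lborel) \<le> ennreal 2" .
  define f where "f t = lim (\<lambda>n. F n t)" for t
  have f[measurable]: "f \<in> borel_measurable borel"
    unfolding f_def by (intro borel_measurable_lim_metric F)
  have "AE t in lborel. S t \<noteq> \<infinity>"
    by (rule nn_integral_noteq_infinite) (use S2 in \<open>auto simp: top_unique\<close>)
  then have AE: "AE t in lborel. \<forall>n. ennreal ((norm (F n t - f t))\<^sup>2) \<le> ennreal (4 * (1 / 4) ^ n) * S t"
  proof eventually_elim
    fix t assume "S t \<noteq> \<infinity>"
    then obtain s where s: "S t = ennreal s" "0 \<le> s" by (cases "S t") auto
    define r where "r = sqrt s"
    have r: "0 \<le> r" "r\<^sup>2 = s" using s by (auto simp: r_def)
    have st: "norm (F n t - F (Suc n) t) \<le> r * (1 / 2) ^ n" for n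
    proof -
      have "(\<Sum>k\<in>{n}. ennreal (4 ^ k) * ennreal ((norm (F k t - F (Suc k) t))\<^sup>2)) \<le> S t"
        unfolding S_def by (intro sum_le_suminf) auto
      then have "ennreal (4 ^ n * (norm (F n t - F (Suc n) t))\<^sup>2) \<le> ennreal s"
        using s by (simp add: ennreal_mult)
      then have "4 ^ n * (norm (F n t - F (Suc n) t))\<^sup>2 \<le> r\<^sup>2"
        using s r by (simp add: ennreal_le_iff)
      moreover have "(4::real) ^ n = (2 ^ n)\<^sup>2"
        by (simp add: power2_eq_square flip: power_mult_distrib)
      ultimately have "(2 ^ n * norm (F n t - F (Suc n) t))\<^sup>2 \<le> r\<^sup>2"
        by (simp add: power_mult_distrib)
      then have "2 ^ n * norm (F n t - F (Suc n) t) \<le> r"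
        using r(1) by (rule power2_le_imp_le)
      then show ?thesis by (simp add: field_simps power_one_over)
    qed
    have b: "norm (F n t - F (n + k) t) \<le> 2 * r * (1 / 2) ^ n" for n k
    proof -
      have "0 \<le> 2 * r * (1 / 2) ^ (n + k)" using r(1) by simp
      then show ?thesis using geometric_steps_bound[of "\<lambda>n. F n t" r n k, OF st] by linarith
    qed
    have "Cauchy (\<lambda>n. F n t)"
    proof (rule CauchyI')
      fix e :: real assume "0 < e"
      have "(\<lambda>n. 2 * r * (1 / 2) ^ n) \<longlonglongrightarrow> 2 * r * 0"
        by (intro tendsto_intros LIMSEQ_power_zero) auto
      then have "eventually (\<lambda>n. 2 * r * (1 / 2) ^ n < e) sequentially"
        using \<open>0 < e\<close> by (intro order_tendstoD) auto
      then obtain M where M: "\<And>n. n \<ge> M \<Longrightarrow> 2 * r * (1 / 2) ^ n < e"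
        by (auto simp: eventually_sequentially)
      show "\<exists>M. \<forall>m\<ge>M. \<forall>n>m. dist (F m t) (F n t) < e"
      proof (intro exI allI impI)
        fix m n assume "M \<le> m" "m < n"
        then show "dist (F m t) (F n t) < e"
          using b[of m "n - m"] M[of m] by (simp add: dist_norm)
      qed
    qed
    then have lim: "(\<lambda>n. F n t) \<longlonglongrightarrow> f t"
      unfolding f_def by (simp add: Cauchy_convergent_iff convergent_LIMSEQ_iff)
    show "\<forall>n. ennreal ((norm (F n t - f t))\<^sup>2) \<le> ennreal (4 * (1 / 4) ^ n) * S t"
    proof
      fix n
      have "(\<lambda>k. norm (F n t - F (n + k) t)) \<longlonglongrightarrow> norm (F n t - f t)"
        using LIMSEQ_ignore_initial_segment[OF lim, of n] by (intro tendsto_intros) (simp add: add.commute)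
      then have "norm (F n t - f t) \<le> 2 * r * (1 / 2) ^ n"
        by (rule LIMSEQ_le_const2) (use b in auto)
      then have "(norm (F n t - f t))\<^sup>2 \<le> (2 * r * (1 / 2) ^ n)\<^sup>2"
        by (intro power_mono) auto
      also have "\<dots> = 4 * (1 / 4) ^ n * s"
      proof -
        have "((1 / 2 :: real) ^ n)\<^sup>2 = (1 / 4) ^ n"
          by (simp add: power2_eq_square flip: power_mult_distrib)
        then show ?thesis using r(2) by (simp add: power_mult_distrib)
      qed
      finally show "ennreal ((norm (F n t - f t))\<^sup>2) \<le> ennreal (4 * (1 / 4) ^ n) * S t"
        using s by (simp add: ennreal_leI flip: ennreal_mult)
    qed
  qed
  have "L2_dist_sq (F n) f \<le> ennreal (8 * (1 / 4) ^ n)" for n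
  proof -
    have "L2_dist_sq (F n) f \<le> (\<integral>\<^sup>+ t. ennreal (4 * (1 / 4) ^ n) * S t \<partial>lborel)"
      unfolding L2_dist_sq_def by (intro nn_integral_mono_AE) (use AE in eventually_elim, auto)
    also have "\<dots> = ennreal (4 * (1 / 4) ^ n) * (\<integral>\<^sup>+ t. S t \<partial>lborel)"
      by (intro nn_integral_cmult) measurable
    also have "\<dots> \<le> ennreal (4 * (1 / 4) ^ n) * ennreal 2"
      by (intro mult_left_mono S2) auto
    also have "\<dots> = ennreal (8 * (1 / 4) ^ n)"
      by (subst ennreal_mult[symmetric]) auto
    finally show ?thesis .
  qed
  then show ?thesis using f that by blast
qed

text \<open>
  Lifting along a fast subsequence, each measure from the representation of its predecessor, turns a Cauchy
  sequence of measures into a Cauchy sequence in \<open>L\<^sup>2\<close>. The law of its limit is the limit of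
  the measures.
\<close>

lemma wasserstein_complete: "Metric_space.mcomplete (\<Lambda>\<^sub>2 :: 'a::euclidean_space measure set) levy_wasserstein"
proof -
  interpret Metric_space "\<Lambda>\<^sub>2 :: 'a measure set" levy_wasserstein by (rule wasserstein_metric)
  show ?thesis
    unfolding mcomplete_def
  proof (intro allI impI)
    fix \<sigma> :: "nat \<Rightarrow> 'a measure" assume \<sigma>: "MCauchy \<sigma>"
    then have \<sigma>in: "\<sigma> n \<in> \<Lambda>\<^sub>2" for n by (auto simp: MCauchy_def)
    let ?a = "\<lambda>n::nat. (1 / 4) ^ n / 2 :: real"
    have N: "\<exists>N. \<forall>k\<ge>N. \<forall>l\<ge>N. levy_wasserstein (\<sigma> k) (\<sigma> l) < ?a n" for n
      using \<sigma> unfolding MCauchy_def by (metis half_gt_zero zero_less_divide_1_iff zero_less_numeral zero_less_power)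
    have "\<exists>r. \<forall>n. (\<forall>k\<ge>r n. \<forall>l\<ge>r n. levy_wasserstein (\<sigma> k) (\<sigma> l) < ?a n) \<and> r n < r (Suc n)"
    proof (intro dependent_nat_choice)
      show "\<exists>N. \<forall>k\<ge>N. \<forall>l\<ge>N. levy_wasserstein (\<sigma> k) (\<sigma> l) < ?a 0" by (rule N)
      fix x n
      obtain N' where "\<forall>k\<ge>N'. \<forall>l\<ge>N'. levy_wasserstein (\<sigma> k) (\<sigma> l) < ?a (Suc n)" using N by blast
      then show "\<exists>y. (\<forall>k\<ge>y. \<forall>l\<ge>y. levy_wasserstein (\<sigma> k) (\<sigma> l) < ?a (Suc n)) \<and> x < y"
        by (intro exI[of _ "max N' (Suc x)"]) auto
    qed
    then obtain r where r: "\<And>n k l. k \<ge> r n \<Longrightarrow> l \<ge> r n \<Longrightarrow> levy_wasserstein (\<sigma> k) (\<sigma> l) < ?a n"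
      and rS: "\<And>n. r n < r (Suc n)" by blast
    have mono: "strict_mono r" using rS by (simp add: strict_mono_Suc_iff)
    have W: "levy_wasserstein (\<sigma> (r n)) (\<sigma> (r (Suc n))) < ?a n" for n
      using rS[of n] by (intro r) auto
    have "\<exists>F. \<forall>n. F n \<in> levy_rep (\<sigma> (r n)) \<and> L2_dist_sq (F n) (F (Suc n)) \<le> ennreal ((1 / 16) ^ n)"
    proof (intro dependent_nat_choice)
      show "\<exists>f. f \<in> levy_rep (\<sigma> (r 0))" using levy_rep_exists[OF \<sigma>in] by blast
      fix f n assume f: "f \<in> levy_rep (\<sigma> (r n))"
      obtain g where "g \<in> levy_rep (\<sigma> (r (Suc n)))" "L2_dist_sq f g \<le> ennreal (2 * (?a n)\<^sup>2)"
        using lift_wasserstein[OF \<sigma>in \<sigma>in f W] by blast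
      moreover have "2 * (?a n)\<^sup>2 \<le> (1 / 16) ^ n"
        by (simp add: power2_eq_square flip: power_mult_distrib)
      ultimately show "\<exists>g. g \<in> levy_rep (\<sigma> (r (Suc n))) \<and> L2_dist_sq f g \<le> ennreal ((1 / 16) ^ n)"
        by (meson ennreal_leI order_trans)
    qed
    then obtain F where F: "\<And>n. F n \<in> levy_rep (\<sigma> (r n))"
      and step: "\<And>n. L2_dist_sq (F n) (F (Suc n)) \<le> ennreal ((1 / 16) ^ n)" by blast
    obtain f where f: "f \<in> borel_measurable borel"
      and conv: "\<And>n. L2_dist_sq (F n) f \<le> ennreal (8 * (1 / 4) ^ n)"
      using fast_L2_Cauchy_converges[of F, OF levy_rep_measurable[OF F] step] by blast
    have \<mu>: "levy_law f \<in> \<Lambda>\<^sub>2"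
    proof (intro levy_law_in_Lambda2 f L2_norm_finite_of_dist[of "F 0" f] levy_rep_measurable[OF F])
      show "(\<integral>\<^sup>+ t. ennreal ((norm (F 0 t))\<^sup>2) \<partial>lborel) < \<infinity>"
        by (rule L2_norm_rep_finite[OF \<sigma>in F])
      show "L2_dist_sq (F 0) f < \<infinity>" using conv[of 0] by (rule le_less_trans) simp
    qed
    have le: "levy_wasserstein (\<sigma> (r n)) (levy_law f) \<le> 2 * (1 / 2) ^ n" for n
    proof (rule wasserstein_le_of_L2[OF levy_rep_measurable[OF F] f levy_rep_law[OF F] refl \<sigma>in \<mu>])
      have "2 * (2 * (1 / 2) ^ n)\<^sup>2 = 8 * (1 / 4 :: real) ^ n"
        by (simp add: power2_eq_square flip: power_mult_distrib)
      then show "L2_dist_sq (F n) f \<le> ennreal (2 * (2 * (1 / 2) ^ n)\<^sup>2)" using conv by metis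
    qed auto
    have "(\<lambda>n. 2 * (1 / 2) ^ n :: real) \<longlonglongrightarrow> 2 * 0"
      by (intro tendsto_intros LIMSEQ_power_zero) auto
    then have lim0: "(\<lambda>n. 2 * (1 / 2) ^ n :: real) \<longlonglongrightarrow> 0" by simp
    have "(\<lambda>n. levy_wasserstein (\<sigma> (r n)) (levy_law f)) \<longlonglongrightarrow> 0"
      by (rule tendsto_sandwich[OF _ _ tendsto_const lim0])
        (simp_all add: wasserstein_nonneg le)
    then have "limitin mtopology (\<sigma> \<circ> r) (levy_law f) sequentially"
      using \<mu> \<sigma>in by (simp add: limitin_metric_dist_null)
    then show "\<exists>x. limitin mtopology \<sigma> x sequentially"
      using MCauchy_convergent_subsequence[OF \<sigma> mono] by blast
  qed
qed

section \<open>Separability\<close>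

lemma rational_mass_subset:
  fixes A :: "real set"
  assumes A[measurable]: "A \<in> sets borel" and fin: "emeasure lborel A < \<infinity>" and \<eta>: "0 < \<eta>"
  shows "\<exists>A' r. A' \<in> sets borel \<and> A' \<subseteq> A \<and> emeasure lborel A' = ennreal (of_rat r)
    \<and> emeasure lborel (A - A') \<le> ennreal \<eta>"
proof (cases "emeasure lborel A = 0")
  case True
  then show ?thesis by (intro exI[of _ "{}"] exI[of _ 0]) simp
next
  case False
  define c where "c = measure lborel A"
  have c: "emeasure lborel A = ennreal c" unfolding c_def
    using fin by (intro emeasure_eq_ennreal_measure) auto
  then have "0 < c" using False by (metis ennreal_eq_0_iff not_less)
  then have "max 0 (c - \<eta>) < c" using \<eta> by simp
  then obtain r where r: "max 0 (c - \<eta>) < of_rat r" "of_rat r < c" using of_rat_dense by blast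
  have "ennreal (of_rat r) < emeasure lborel A"
    using r c by (simp add: ennreal_less_iff)
  then obtain t where t: "emeasure lborel (A \<inter> {-t..t}) = ennreal (of_rat r)"
    using borel_subset_of_mass[OF A, of "of_rat r"] r(1) by auto
  have "emeasure lborel (A - A \<inter> {-t..t}) = emeasure lborel A - emeasure lborel (A \<inter> {-t..t})"
    by (intro emeasure_Diff) (auto simp: t)
  also have "\<dots> = ennreal (c - of_rat r)"
    unfolding t c using r(1) by (intro ennreal_minus) auto
  also have "\<dots> \<le> ennreal \<eta>" using r(1) by (intro ennreal_leI) auto
  finally show ?thesis
    using t by (intro exI[of _ "A \<inter> {-t..t}"] exI[of _ r]) auto
qed

text \<open>
  This determines \<open>\<rho>\<close> off the origin as the sum of the point masses \<open>rs ! i\<close> at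
  \<open>d i\<close>. The index set of lists of rationals is what makes the family of these measures countable.
\<close>

definition atomic_on :: "(nat \<Rightarrow> 'a::euclidean_space) \<Rightarrow> rat list \<Rightarrow> 'a measure \<Rightarrow> bool" where
  "atomic_on d rs \<rho> \<longleftrightarrow> (\<forall>E\<in>sets borel. 0 \<notin> E \<longrightarrow>
     emeasure \<rho> E = (\<Sum>i<length rs. ennreal (of_rat (rs ! i)) * indicator E (d i)))"

lemma atomic_on_unique:
  assumes "atomic_on d rs \<rho>" "atomic_on d rs \<rho>'" "levy_measure \<rho>" "levy_measure \<rho>'"
  shows "\<rho> = \<rho>'"
proof (rule measure_eqI)
  have s: "sets \<rho> = sets borel" "sets \<rho>' = sets borel" and z: "emeasure \<rho> {0} = 0" "emeasure \<rho>' {0} = 0"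
    using assms by (auto simp: levy_measure_def)
  then show "sets \<rho> = sets \<rho>'" by simp
  fix E assume "E \<in> sets \<rho>"
  then have E: "E \<in> sets borel" using s by simp
  have "emeasure \<rho> E = emeasure \<rho> (E - {0})" "emeasure \<rho>' E = emeasure \<rho>' (E - {0})"
    by (rule emeasure_Diff_null_set[symmetric]; use E s z in auto)+
  moreover have "emeasure \<rho> (E - {0}) = emeasure \<rho>' (E - {0})"
    using assms(1,2) E unfolding atomic_on_def by auto
  ultimately show "emeasure \<rho> E = emeasure \<rho>' E" by simp
qed

lemma countable_atomic: "countable {\<rho> \<in> \<Lambda>\<^sub>2. \<exists>rs. atomic_on d rs \<rho>}"
proof -
  have "{\<rho> \<in> \<Lambda>\<^sub>2. \<exists>rs. atomic_on d rs \<rho>} \<subseteq> range (\<lambda>rs. THE \<rho>. \<rho> \<in> \<Lambda>\<^sub>2 \<and> atomic_on d rs \<rho>)"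
  proof
    fix \<rho> assume "\<rho> \<in> {\<rho> \<in> \<Lambda>\<^sub>2. \<exists>rs. atomic_on d rs \<rho>}"
    then obtain rs where "\<rho> \<in> \<Lambda>\<^sub>2 \<and> atomic_on d rs \<rho>" by blast
    then have "\<rho> = (THE \<rho>. \<rho> \<in> \<Lambda>\<^sub>2 \<and> atomic_on d rs \<rho>)"
      by (intro the_equality[symmetric]) (auto intro: atomic_on_unique Lambda2_levy)
    then show "\<rho> \<in> range (\<lambda>rs. THE \<rho>. \<rho> \<in> \<Lambda>\<^sub>2 \<and> atomic_on d rs \<rho>)"
      by (rule range_eqI)
  qed
  then show ?thesis by (rule countable_subset) auto
qed

lemma atomic_law_of_step_function:
  fixes d :: "nat \<Rightarrow> 'a::euclidean_space" and A :: "nat \<Rightarrow> real set"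
  assumes A[measurable]: "\<And>n. A n \<in> sets borel" and disj: "disjoint_family A"
    and mass: "\<And>n. emeasure lborel (A n) = ennreal (of_rat (r n))"
    and g[measurable]: "g \<in> borel_measurable borel"
    and gA: "\<And>n t. t \<in> A n \<Longrightarrow> n < N \<Longrightarrow> g t = d n" and g0: "\<And>t. t \<notin> (\<Union>n<N. A n) \<Longrightarrow> g t = 0"
  shows "atomic_on d (map r [0..<N]) (levy_law g)"
  unfolding atomic_on_def
proof (intro ballI impI)
  fix E :: "'a set" assume E: "E \<in> sets borel" and E0: "0 \<notin> E"
  have "g -` E = (\<Union>n\<in>{n. n < N \<and> d n \<in> E}. A n)"
    using gA g0 E0 by force
  then have "emeasure (levy_law g) E = emeasure lborel (\<Union>n\<in>{n. n < N \<and> d n \<in> E}. A n)"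
    using emeasure_levy_law_vimage[OF g E E0] by simp
  also have "\<dots> = (\<Sum>n\<in>{n. n < N \<and> d n \<in> E}. emeasure lborel (A n))"
    by (intro sum_emeasure[symmetric]) (use disj in \<open>auto simp: disjoint_family_on_def\<close>)
  also have "\<dots> = (\<Sum>n<N. ennreal (of_rat (r n)) * indicator E (d n))"
    by (rule sum.mono_neutral_cong_left) (auto simp: mass)
  finally show "emeasure (levy_law g) E
      = (\<Sum>i<length (map r [0..<N]). ennreal (of_rat (map r [0..<N] ! i)) * indicator E (d i))"
    by simp
qed

text \<open>
  Let \<open>f\<close> represent \<open>\<mu>\<close>. On a subset of rational measure of each cell
  \<open>f\<close> is replaced by the centre of the cell, for finitely many cells only, and by 0 everywhere
  else. The three errors, namely rounding, discarding the remainders of the cells, and discarding the tail of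
  the sequence of cells, contribute at most \<open>\<theta>\<close> each to the squared distance.
\<close>

lemma atomic_dense:
  fixes \<mu> :: "'a::euclidean_space measure" and d :: "nat \<Rightarrow> 'a"
  assumes \<mu>: "\<mu> \<in> \<Lambda>\<^sub>2" and e: "0 < e"
    and d: "d 0 = 0" "\<And>X. open X \<Longrightarrow> X \<noteq> {} \<Longrightarrow> \<exists>n. d n \<in> X"
  shows "\<exists>\<rho>\<in>\<Lambda>\<^sub>2. (\<exists>rs. atomic_on d rs \<rho>) \<and> levy_wasserstein \<mu> \<rho> \<le> e"
proof -
  obtain f where f: "f \<in> levy_rep \<mu>" using levy_rep_exists[OF \<mu>] by blast
  note fm[measurable] = levy_rep_measurable[OF f]
  note f2 = L2_norm_rep_finite[OF \<mu> f]
  define M where "M = enn2real (\<integral>\<^sup>+ t. ennreal ((norm (f t))\<^sup>2) \<partial>lborel)"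
  have M: "(\<integral>\<^sup>+ t. ennreal ((norm (f t))\<^sup>2) \<partial>lborel) = ennreal M"
    unfolding M_def using f2 by (subst ennreal_enn2real) auto
  have M0: "0 \<le> M" by (simp add: M_def)
  define \<theta> where "\<theta> = e\<^sup>2 / 2"
  have \<theta>: "0 < \<theta>" using e by (simp add: \<theta>_def)
  define \<epsilon> where "\<epsilon> = min (1/2) (\<theta> / (M + 1))"
  have \<epsilon>: "0 < \<epsilon>" "\<epsilon> < 1" using \<theta> M0 by (auto simp: \<epsilon>_def)
  have \<epsilon>M: "\<epsilon>\<^sup>2 * M \<le> \<theta>"
  proof -
    have "\<epsilon>\<^sup>2 * M \<le> \<epsilon> * (M + 1)"
      using \<epsilon> M0 by (intro mult_mono) (auto simp: power2_eq_square mult_left_le)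
    also have "\<dots> \<le> \<theta> / (M + 1) * (M + 1)"
      using M0 by (intro mult_right_mono) (auto simp: \<epsilon>_def)
    also have "\<dots> = \<theta>" using M0 by simp
    finally show ?thesis .
  qed
  obtain q where q[measurable]: "q \<in> measurable borel (count_space UNIV)"
    and dq: "\<And>x. norm (x - d (q x)) \<le> \<epsilon> * norm x"
    and away: "\<And>n. \<exists>r>0. \<forall>x. x \<noteq> 0 \<and> q x = n \<longrightarrow> r \<le> norm x"
    using relative_quantisation[OF \<epsilon> d] by metis
  have far: "norm x \<le> 2 * norm (d (q x))" for x
  proof -
    have "norm x \<le> norm (d (q x)) + norm (x - d (q x))" by (rule norm_triangle_sub)
    also have "norm (x - d (q x)) \<le> norm x / 2"
    proof -
      have "\<epsilon> * norm x \<le> 1 / 2 * norm x" unfolding \<epsilon>_def by (intro mult_right_mono min.cobounded1) auto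
      then show ?thesis using dq[of x] by simp
    qed
    finally show ?thesis by simp
  qed
  define A where "A n = {t. f t \<noteq> 0 \<and> q (f t) = n}" for n
  have A[measurable]: "A n \<in> sets borel" for n unfolding A_def by measurable
  have Adisj: "disjoint_family A" by (auto simp: disjoint_family_on_def A_def)
  have Afin: "emeasure lborel (A n) < \<infinity>" for n
  proof -
    obtain r where r: "0 < r" "\<forall>x. x \<noteq> 0 \<and> q x = n \<longrightarrow> r \<le> norm x" using away by blast
    let ?B = "{x. x \<noteq> 0 \<and> q x = n}"
    have B: "?B \<in> sets borel" by measurable
    have "emeasure \<mu> ?B < \<infinity>"
      using r by (intro levy_measure_finite_away[OF Lambda2_levy[OF \<mu>] B, of "ball 0 r"]) (auto simp: not_less[symmetric])
    moreover have "emeasure \<mu> ?B = emeasure lborel (f -` ?B)"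
      using emeasure_levy_law_vimage[OF fm B] levy_rep_law[OF f] by auto
    ultimately show ?thesis by (simp add: A_def vimage_def)
  qed
  \<comment> \<open>On the \<open>n\<close>-th cell the square of \<open>f\<close> is at most \<open>4 * (norm (d n))\<^sup>2\<close>, so discarding mass \<open>\<eta> n\<close>
    there costs at most the \<open>n\<close>-th term of a geometric series with sum \<open>\<theta>\<close>.\<close>
  define \<eta> where "\<eta> n = \<theta> * (1/2) ^ Suc n / (4 * (norm (d n))\<^sup>2 + 1)" for n
  have \<eta>: "0 < \<eta> n" for n using \<theta> by (auto simp: \<eta>_def intro!: divide_pos_pos add_nonneg_pos)
  have "\<exists>A' r. A' \<in> sets borel \<and> A' \<subseteq> A n \<and> emeasure lborel A' = ennreal (of_rat r)
    \<and> emeasure lborel (A n - A') \<le> ennreal (\<eta> n)" for n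
    by (rule rational_mass_subset[OF A Afin \<eta>])
  then have "\<forall>n. \<exists>A' r. A' \<in> sets borel \<and> A' \<subseteq> A n \<and> emeasure lborel A' = ennreal (of_rat r)
    \<and> emeasure lborel (A n - A') \<le> ennreal (\<eta> n)" by blast
  then obtain A' r where A'[measurable]: "\<And>n. A' n \<in> sets borel" and A'sub: "\<And>n. A' n \<subseteq> A n"
    and A'mass: "\<And>n. emeasure lborel (A' n) = ennreal (of_rat (r n))"
    and A'rest: "\<And>n. emeasure lborel (A n - A' n) \<le> ennreal (\<eta> n)"
    unfolding choice_iff by blast
  have A'q: "f t \<noteq> 0 \<and> q (f t) = n" if "t \<in> A' n" for t n
    using A'sub[of n] that by (auto simp: A_def)
  have A'disj: "disjoint_family A'"
    using Adisj A'sub unfolding disjoint_family_on_def by blast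
  define R where "R n = A n - A' n" for n
  have R[measurable]: "R n \<in> sets borel" for n by (simp add: R_def)
  have rest: "(\<integral>\<^sup>+ t. (\<Sum>n. ennreal ((norm (f t))\<^sup>2) * indicator (R n) t) \<partial>lborel) \<le> ennreal \<theta>"
  proof -
    have "(\<integral>\<^sup>+ t. (\<Sum>n. ennreal ((norm (f t))\<^sup>2) * indicator (R n) t) \<partial>lborel)
        = (\<Sum>n. \<integral>\<^sup>+ t. ennreal ((norm (f t))\<^sup>2) * indicator (R n) t \<partial>lborel)"
      by (intro nn_integral_suminf) measurable
    also have "\<dots> \<le> (\<Sum>n. ennreal (\<theta> * (1/2) ^ Suc n))"
    proof (intro suminf_le)
      fix n
      have "(\<integral>\<^sup>+ t. ennreal ((norm (f t))\<^sup>2) * indicator (R n) t \<partial>lborel)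
          \<le> (\<integral>\<^sup>+ t. ennreal (4 * (norm (d n))\<^sup>2) * indicator (R n) t \<partial>lborel)"
      proof (intro nn_integral_mono)
        fix t
        have "(norm (f t))\<^sup>2 \<le> 4 * (norm (d n))\<^sup>2" if "t \<in> R n"
        proof -
          have "norm (f t) \<le> 2 * norm (d n)" using far[of "f t"] that by (auto simp: R_def A_def)
          then have "(norm (f t))\<^sup>2 \<le> (2 * norm (d n))\<^sup>2" by (intro power_mono) auto
          then show ?thesis by (simp add: power_mult_distrib)
        qed
        then show "ennreal ((norm (f t))\<^sup>2) * indicator (R n) t \<le> ennreal (4 * (norm (d n))\<^sup>2) * indicator (R n) t"
          by (auto simp: indicator_def intro!: ennreal_leI)
      qed
      also have "\<dots> = ennreal (4 * (norm (d n))\<^sup>2) * emeasure lborel (R n)"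
        by (intro nn_integral_cmult_indicator) auto
      also have "\<dots> \<le> ennreal (4 * (norm (d n))\<^sup>2) * ennreal (\<eta> n)"
        using A'rest by (intro mult_left_mono) (auto simp: R_def)
      also have "\<dots> = ennreal (4 * (norm (d n))\<^sup>2 * \<eta> n)"
        using \<eta>[of n] by (simp add: ennreal_mult)
      also have "\<dots> \<le> ennreal (\<theta> * (1/2) ^ Suc n)"
      proof (intro ennreal_leI)
        have "4 * (norm (d n))\<^sup>2 * \<eta> n \<le> (4 * (norm (d n))\<^sup>2 + 1) * \<eta> n"
          using \<eta>[of n] by (intro mult_right_mono) auto
        also have "\<dots> = \<theta> * (1/2) ^ Suc n"
        proof -
          have "4 * (norm (d n))\<^sup>2 + 1 \<noteq> 0" using zero_le_power2[of "norm (d n)"] by linarith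
          moreover have "c * (b / c) = b" if "c \<noteq> 0" for b c :: real using that by simp
          ultimately show ?thesis unfolding \<eta>_def by blast
        qed
        finally show "4 * (norm (d n))\<^sup>2 * \<eta> n \<le> \<theta> * (1/2) ^ Suc n" .
      qed
      finally show "(\<integral>\<^sup>+ t. ennreal ((norm (f t))\<^sup>2) * indicator (R n) t \<partial>lborel) \<le> ennreal (\<theta> * (1/2) ^ Suc n)" .
    qed auto
    also have "\<dots> = ennreal (\<theta> * 1)"
      using \<theta> by (intro suminf_ennreal_eq sums_mult power_half_series) simp
    also have "\<theta> * 1 = \<theta>" by simp
    finally show ?thesis .
  qed
  define u where "u N t = ennreal ((norm (f t))\<^sup>2) * indicator {t. N \<le> q (f t)} t" for N t
  have u[measurable]: "u N \<in> borel_measurable lborel" for N unfolding u_def by measurable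
  have "(\<lambda>N. \<integral>\<^sup>+ t. u N t \<partial>lborel) \<longlonglongrightarrow> (\<integral>\<^sup>+ t. 0 \<partial>(lborel :: real measure))"
  proof (rule nn_integral_dominated_convergence[where w="\<lambda>t. ennreal ((norm (f t))\<^sup>2)"])
    show "AE t in lborel. (\<lambda>N. u N t) \<longlonglongrightarrow> 0"
    proof (intro AE_I2)
      fix t
      have "eventually (\<lambda>N. u N t = 0) sequentially"
        using eventually_gt_at_top[of "q (f t)"] by eventually_elim (simp add: u_def)
      then show "(\<lambda>N. u N t) \<longlonglongrightarrow> 0" by (rule tendsto_eventually)
    qed
    show "AE t in lborel. u N t \<le> ennreal ((norm (f t))\<^sup>2)" for N
      by (intro AE_I2) (simp add: u_def indicator_def)
    show "(\<integral>\<^sup>+ t. ennreal ((norm (f t))\<^sup>2) \<partial>lborel) < \<infinity>" by (rule f2)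
  qed auto
  then have "eventually (\<lambda>N. (\<integral>\<^sup>+ t. u N t \<partial>lborel) < ennreal \<theta>) sequentially"
    using \<theta> by (intro order_tendstoD) auto
  then obtain N where N: "(\<integral>\<^sup>+ t. u N t \<partial>lborel) < ennreal \<theta>"
    by (auto simp: eventually_sequentially)
  define g where "g t = (\<Sum>n<N. indicat_real (A' n) t *\<^sub>R d n)" for t
  have g[measurable]: "g \<in> borel_measurable borel" unfolding g_def by measurable
  have gA: "g t = d n" if "t \<in> A' n" "n < N" for t n
  proof -
    have "g t = (\<Sum>m<N. if m = n then d n else 0)" unfolding g_def
    proof (intro sum.cong refl)
      fix m
      have "t \<notin> A' m" if "m \<noteq> n"
        using A'disj \<open>t \<in> A' n\<close> that unfolding disjoint_family_on_def by blast
      then show "indicat_real (A' m) t *\<^sub>R d m = (if m = n then d n else 0)"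
        using \<open>t \<in> A' n\<close> by simp
    qed
    then show ?thesis using that by simp
  qed
  have g0: "g t = 0" if "t \<notin> (\<Union>n<N. A' n)" for t
    unfolding g_def using that by (intro sum.neutral) auto
  have atomic: "atomic_on d (map r [0..<N]) (levy_law g)"
    using A' A'disj A'mass g gA g0 by (rule atomic_law_of_step_function)
  have ptw: "ennreal ((norm (f t - g t))\<^sup>2) \<le> ennreal (\<epsilon>\<^sup>2) * ennreal ((norm (f t))\<^sup>2)
      + ((\<Sum>n. ennreal ((norm (f t))\<^sup>2) * indicator (R n) t) + u N t)" for t
  proof -
    consider (zero) "f t = 0" | (good) "f t \<noteq> 0" "q (f t) < N" "t \<in> A' (q (f t))"
      | (rest) "f t \<noteq> 0" "t \<in> R (q (f t))" | (tail) "f t \<noteq> 0" "N \<le> q (f t)"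
      by (auto simp: R_def A_def not_less) (meson not_less)
    then show ?thesis
    proof cases
      case zero
      then have "g t = 0" using A'sub by (intro g0) (auto simp: A_def)
      then show ?thesis using zero by simp
    next
      case good
      then have "(norm (f t - g t))\<^sup>2 \<le> (\<epsilon> * norm (f t))\<^sup>2"
        using dq[of "f t"] gA[of t "q (f t)"] by (intro power_mono) auto
      then have "ennreal ((norm (f t - g t))\<^sup>2) \<le> ennreal (\<epsilon>\<^sup>2) * ennreal ((norm (f t))\<^sup>2)"
        by (simp add: power_mult_distrib ennreal_leI flip: ennreal_mult)
      then show ?thesis by (rule order_trans) simp
    next
      case rest
      then have "g t = 0" using A'sub by (intro g0) (auto simp: A_def R_def)
      moreover have "(\<Sum>n. ennreal ((norm (f t))\<^sup>2) * indicator (R n) t) = ennreal ((norm (f t))\<^sup>2)"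
        using rest(2) Adisj by (intro suminf_cmult_indicator) (auto simp: disjoint_family_on_def R_def)
      ultimately show ?thesis by (simp add: add_increasing add_increasing2)
    next
      case tail
      then have "t \<notin> A' n" if "n < N" for n using A'q[of t n] that by auto
      then have "g t = 0" by (intro g0) auto
      then show ?thesis using tail unfolding u_def by (simp add: add_increasing add_increasing2)
    qed
  qed
  have "L2_dist_sq f g \<le> (\<integral>\<^sup>+ t. ennreal (\<epsilon>\<^sup>2) * ennreal ((norm (f t))\<^sup>2)
      + ((\<Sum>n. ennreal ((norm (f t))\<^sup>2) * indicator (R n) t) + u N t) \<partial>lborel)"
    unfolding L2_dist_sq_def by (intro nn_integral_mono ptw)
  also have "\<dots> = ennreal (\<epsilon>\<^sup>2) * ennreal M
      + ((\<integral>\<^sup>+ t. (\<Sum>n. ennreal ((norm (f t))\<^sup>2) * indicator (R n) t) \<partial>lborel) + (\<integral>\<^sup>+ t. u N t \<partial>lborel))"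
    by (simp add: nn_integral_add nn_integral_cmult M)
  also have "\<dots> \<le> ennreal \<theta> + (ennreal \<theta> + ennreal \<theta>)"
  proof (intro add_mono)
    show "ennreal (\<epsilon>\<^sup>2) * ennreal M \<le> ennreal \<theta>"
      using \<epsilon>M M0 by (subst ennreal_mult[symmetric]) (auto intro: ennreal_leI)
  qed (use rest N in auto)
  also have "\<dots> = ennreal (3 * \<theta>)" using \<theta> by (simp flip: ennreal_plus)
  also have "\<dots> \<le> ennreal (2 * e\<^sup>2)" using e by (intro ennreal_leI) (simp add: \<theta>_def)
  finally have fg: "L2_dist_sq f g \<le> ennreal (2 * e\<^sup>2)" .
  have \<rho>: "levy_law g \<in> \<Lambda>\<^sub>2"
  proof (intro levy_law_in_Lambda2 g L2_norm_finite_of_dist[of f g] fm f2)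
    show "L2_dist_sq f g < \<infinity>" using fg by (rule le_less_trans) simp
  qed
  have "levy_wasserstein \<mu> (levy_law g) \<le> e"
    using e by (intro wasserstein_le_of_L2[OF fm g levy_rep_law[OF f] refl \<mu> \<rho> fg]) auto
  then show ?thesis using \<rho> atomic by blast
qed

lemma wasserstein_separable:
  "separable_space (Metric_space.mtopology (\<Lambda>\<^sub>2 :: 'a::euclidean_space measure set) levy_wasserstein)"
proof -
  interpret Metric_space "\<Lambda>\<^sub>2 :: 'a measure set" levy_wasserstein by (rule wasserstein_metric)
  obtain d :: "nat \<Rightarrow> 'a" where d: "d 0 = 0" "\<And>X. open X \<Longrightarrow> X \<noteq> {} \<Longrightarrow> \<exists>n. d n \<in> X"
    using dense_sequence_starting_at_zero by metis
  let ?D = "{\<rho> \<in> \<Lambda>\<^sub>2. \<exists>rs. atomic_on d rs \<rho>}"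
  have "mtopology closure_of ?D = \<Lambda>\<^sub>2"
    unfolding metric_closure_of
  proof (intro equalityI subsetI CollectI conjI allI impI)
    fix \<mu> :: "'a measure" and e :: real assume \<mu>: "\<mu> \<in> \<Lambda>\<^sub>2" and "0 < e"
    then obtain \<rho> where "\<rho> \<in> ?D" "levy_wasserstein \<mu> \<rho> \<le> e / 2"
      using atomic_dense[OF \<mu> half_gt_zero[OF \<open>0 < e\<close>] d] by blast
    moreover from this have "\<rho> \<in> mball \<mu> e"
      using \<mu> \<open>0 < e\<close> by simp
    ultimately show "\<exists>\<rho>\<in>?D. \<rho> \<in> mball \<mu> e" by blast
  qed auto
  then show ?thesis
    unfolding separable_space_def by (intro exI[of _ ?D]) (auto simp: countable_atomic)
qed

theorem corollary2p34:
  shows "(\<forall>\<mu> \<in> (\<Lambda>\<^sub>2 :: (real ^ 'n) measure set). \<forall>\<nu> \<in> \<Lambda>\<^sub>2. levy_cost2 \<mu> \<nu> < \<infinity>) \<and>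
    Metric_space (\<Lambda>\<^sub>2 :: (real ^ 'n) measure set) levy_wasserstein \<and>
    Metric_space.mcomplete (\<Lambda>\<^sub>2 :: (real ^ 'n) measure set) levy_wasserstein \<and>
    separable_space (Metric_space.mtopology (\<Lambda>\<^sub>2 :: (real ^ 'n) measure set) levy_wasserstein)"
proof (intro conjI)
  show "\<forall>\<mu> \<in> (\<Lambda>\<^sub>2 :: (real ^ 'n) measure set). \<forall>\<nu> \<in> \<Lambda>\<^sub>2. levy_cost2 \<mu> \<nu> < \<infinity>"
    using levy_cost2_finite by blast
qed (rule wasserstein_metric wasserstein_complete wasserstein_separable)+

end
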